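(* Let $\delta>0$, $\gamma>0$, $\lambda>0$, and let $Y_{\delta,\gamma}(t)=\sum_{i=1}^{N_{\delta,\gamma}(t)}X_i$, $t\ge0$, be the inverse IG fractional compound Poisson process with iid jumps of common distribution $F_X$. Then its probability mass function $P_{\delta,\gamma}(n,t)=\mathbb{P}[Y_{\delta,\gamma}(t)=n]$ satisfies the fractional differential equation $$\mathcal{D}^{\delta,\gamma}_tP_{\delta,\gamma}(n,t)=-\lambda P_{\delta,\gamma}(n,t)+\lambda\int_{-\infty}^\infty P_{\delta,\gamma}(n-x,t)\,F_X(dx).$$
   Context: Let $\{D_{\delta,\gamma}(t)\}_{t\ge0}$ be the inverse Gaussian L\'evy subordinator, $\mathbb{E}[e^{-sD_{\delta,\gamma}(t)}]=e^{-t\delta(\sqrt{2s+\gamma^2}-\gamma)}$, and $E_{\delta,\gamma}(t)=\inf\{r\ge0:D_{\delta,\gamma}(r)>t\}$ its inverse. Let $\{N(t)\}_{t\ge0}$ be a Poisson process with rate $\lambda>0$ independent of $\{E_{\delta,\gamma}(t)\}$, and $N_{\delta,\gamma}(t)=N(E_{\delta,\gamma}(t))$. The iid real jumps $X_i$ with distribution $F_X$ are independent of $N$ and $E_{\delta,\gamma}$, and an empty sum is $0$. The L\'evy measure is $\nu_{\delta,\gamma}(dx)=\frac{\delta}{\sqrt{2\pi x^3}}e^{-\gamma^2x/2}\mathbf{1}_{\{x>0\}}dx$, with tail $$\bar\nu_{\delta,\gamma}(s)=\nu_{\delta,\gamma}((s,\infty))=\sqrt{\tfrac{2}{\pi}}\,\delta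 s^{-1/2}e^{-\gamma^2s/2}-\frac{\delta\gamma}{\sqrt\pi}\Gamma\!\left(\tfrac12;\tfrac{\gamma^2s}{2}\right),\quad s>0,$$ where $\Gamma(a;b)=\int_b^\infty u^{a-1}e^{-u}\,du$. The corresponding generalized Caputo–Djrbashian derivative is $$\mathcal{D}^{\delta,\gamma}_tv(t)=\frac{d}{dt}\int_0^tv(s)\,\bar\nu_{\delta,\gamma}(t-s)\,ds-v(0)\,\bar\nu_{\delta,\gamma}(t).$$ *)

theory Defs
  imports "HOL-Probability.Probability"
begin

text \<open>Real-valued Levy processes indexed by the times \<open>t \<ge> 0\<close>. The values at negative times are
  irrelevant. Path properties are only required almost surely. Stochastic continuity is not listed
  because it follows from right-continuity and stationarity of the increments.\<close>

definition levy_process :: "'a measure \<Rightarrow> (real \<Rightarrow> 'a \<Rightarrow> real) \<Rightarrow> bool" where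
  "levy_process M Z \<longleftrightarrow>
     (\<forall>t\<ge>0. Z t \<in> borel_measurable M) \<and>
     (AE \<omega> in M. Z 0 \<omega> = 0) \<and>
     (\<forall>(\<tau> :: nat \<Rightarrow> real) n. 0 \<le> \<tau> 0 \<longrightarrow> incseq \<tau> \<longrightarrow>
        prob_space.indep_vars M (\<lambda>_. borel) (\<lambda>i \<omega>. Z (\<tau> (Suc i)) \<omega> - Z (\<tau> i) \<omega>) {..<n}) \<and>
     (\<forall>s\<ge>0. \<forall>h\<ge>0. distr M borel (\<lambda>\<omega>. Z (s + h) \<omega> - Z s \<omega>) = distr M borel (Z h)) \<and>
     (AE \<omega> in M. (\<forall>t\<ge>0. ((\<lambda>u. Z u \<omega>) \<longlongrightarrow> Z t \<omega>) (at_right t)) \<and>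
                 (\<forall>t>0. \<exists>l. ((\<lambda>u. Z u \<omega>) \<longlongrightarrow> l) (at_left t)))"

definition levy_subordinator :: "'a measure \<Rightarrow> (real \<Rightarrow> 'a \<Rightarrow> real) \<Rightarrow> bool" where
  "levy_subordinator M D \<longleftrightarrow>
     levy_process M D \<and> (AE \<omega> in M. mono_on {0..} (\<lambda>t. D t \<omega>))"

definition inverse_gaussian_subordinator ::
    "'a measure \<Rightarrow> real \<Rightarrow> real \<Rightarrow> (real \<Rightarrow> 'a \<Rightarrow> real) \<Rightarrow> bool" where
  "inverse_gaussian_subordinator M \<delta> \<gamma> D \<longleftrightarrow>
     levy_subordinator M D \<and>
     (\<forall>t\<ge>0. \<forall>s\<ge>0. (\<integral>\<omega>. exp (- s * D t \<omega>) \<partial>M)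
                    = exp (- t * \<delta> * (sqrt (2 * s + \<gamma>\<^sup>2) - \<gamma>)))"

text \<open>The first-passage time is real-valued; the infimum of the empty set, a junk value, can only
  arise on the null event that the path of the subordinator stays bounded.\<close>

definition inverse_process :: "(real \<Rightarrow> 'a \<Rightarrow> real) \<Rightarrow> real \<Rightarrow> 'a \<Rightarrow> real" where
  "inverse_process D t \<omega> = Inf {r. 0 \<le> r \<and> D r \<omega> > t}"

definition poisson_process :: "'a measure \<Rightarrow> real \<Rightarrow> (real \<Rightarrow> 'a \<Rightarrow> nat) \<Rightarrow> bool" where
  "poisson_process M rate N \<longleftrightarrow>
     levy_process M (\<lambda>t \<omega>. real (N t \<omega>)) \<and>
     (\<forall>t>0. distr M (count_space UNIV) (N t) = measure_pmf (poisson_pmf (rate * t)))"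

definition generated_events ::
    "'a measure \<Rightarrow> 'i set \<Rightarrow> 'b measure \<Rightarrow> ('i \<Rightarrow> 'a \<Rightarrow> 'b) \<Rightarrow> 'a set set" where
  "generated_events M I K Z = sigma_sets (space M) {Z i -` A \<inter> space M | i A. i \<in> I \<and> A \<in> sets K}"

definition compound_process ::
    "(real \<Rightarrow> 'a \<Rightarrow> nat) \<Rightarrow> (nat \<Rightarrow> 'a \<Rightarrow> real) \<Rightarrow> (real \<Rightarrow> 'a \<Rightarrow> real) \<Rightarrow> real \<Rightarrow> 'a \<Rightarrow> real" where
  "compound_process N X T t \<omega> = (\<Sum>i = 1..N (T t \<omega>) \<omega>. X i \<omega>)"

definition ig_levy_measure :: "real \<Rightarrow> real \<Rightarrow> real measure" where
  "ig_levy_measure \<delta> \<gamma> = density lborel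
     (\<lambda>x. ennreal (\<delta> / sqrt (2 * pi * x ^ 3) * exp (- \<gamma>\<^sup>2 * x / 2) * indicator {0<..} x))"

text \<open>Since \<open>measure\<close> is real-valued, the infinite mass of \<open>(0,\<infinity>)\<close> makes the tail \<open>0\<close> at \<open>s = 0\<close>.
  In the convolution below this affects only the null set \<open>{t}\<close>.\<close>

definition ig_levy_tail :: "real \<Rightarrow> real \<Rightarrow> real \<Rightarrow> real" where
  "ig_levy_tail \<delta> \<gamma> s = measure (ig_levy_measure \<delta> \<gamma>) {s<..}"

definition tail_convolution :: "real \<Rightarrow> real \<Rightarrow> (real \<Rightarrow> real) \<Rightarrow> real \<Rightarrow> real" where
  "tail_convolution \<delta> \<gamma> v t = (LINT s:{0..t}|lborel. v s * ig_levy_tail \<delta> \<gamma> (t - s))"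

text \<open>Both \<open>deriv\<close> and the Lebesgue integral are total functions, so existence of the generalized
  Caputo-Djrbashian derivative at \<open>t\<close> is a predicate of its own.\<close>

definition caputo_djrbashian_deriv :: "real \<Rightarrow> real \<Rightarrow> (real \<Rightarrow> real) \<Rightarrow> real \<Rightarrow> real" where
  "caputo_djrbashian_deriv \<delta> \<gamma> v t =
     deriv (tail_convolution \<delta> \<gamma> v) t - v 0 * ig_levy_tail \<delta> \<gamma> t"

definition caputo_djrbashian_differentiable :: "real \<Rightarrow> real \<Rightarrow> (real \<Rightarrow> real) \<Rightarrow> real \<Rightarrow> bool" where
  "caputo_djrbashian_differentiable \<delta> \<gamma> v t \<longleftrightarrow>
     (\<forall>\<^sub>F u in nhds t. set_integrable lborel {0..u} (\<lambda>s. v s * ig_levy_tail \<delta> \<gamma> (u - s))) \<and>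
     tail_convolution \<delta> \<gamma> v field_differentiable (at t)"

end

theory Submission
  imports Defs "HOL-Real_Asymp.Real_Asymp"
begin

text \<open>Conditioning on the time change gives \<open>P n t = expectation (g (E t))\<close> for the Poisson mean \<open>g\<close> of the
  point masses of the partial sums of the jumps. Here \<open>g' = rate * (h - g)\<close>, where \<open>h\<close> is \<open>g\<close> with one more
  jump, so the right-hand side of the equation is \<open>expectation (g' (E t))\<close>. It remains to show that this is the
  Caputo-Djrbashian derivative of \<open>expectation (g (E t))\<close>. Let \<open>\<phi>\<close> be the Laplace exponent of \<open>D\<close>. Up to a
  null set of times \<open>s\<close>, \<open>u < E s\<close> holds iff \<open>D u < s\<close>; hence \<open>E\<close> at an independent exponential time of
  rate \<open>\<theta>\<close> is exponential with rate \<open>\<phi> \<theta>\<close>. As the tail of the Levy measure has Laplace transform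
  \<open>\<phi> \<theta> / \<theta>\<close>, the two sides, integrated in time, are continuous with equal Laplace transforms.\<close>

section \<open>Laplace transforms on the half-line\<close>

text \<open>The derivative cannot be transformed directly: its existence is part of the claim, the
  tail is singular at 0, and \<open>v\<close> is only known to be continuous. After one integration
  both sides are continuous and of exponential growth, so equality of transforms gives equality at
  every time, and differentiability is read off from a primitive. The term \<open>v 0\<close> is
  split off beforehand, so that the function convolved with the tail vanishes at 0; its own
  convolution is a multiple of a primitive of the tail, whose derivative is the correction term
  subtracted in the Caputo-Djrbashian derivative.

  The exponential time takes the place of a formula for the law of \<open>E\<close>: the Laplace
  transforms of the single variables \<open>D u\<close> suffice. Paths are regular only almost
  surely, so \<open>E\<close> may take default values on a null event; Poisson means are therefore
  evaluated at \<open>max (E t \<omega>) 0\<close>, where their bounds hold for every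
  \<open>\<omega>\<close>.\<close>

lemma nn_integral_exp_neg:
  fixes a :: real
  assumes "a > 0"
  shows "(\<integral>\<^sup>+t. ennreal (exp (- a * t)) * indicator {c..} t \<partial>lborel) = ennreal (exp (- a * c) / a)"
proof -
  have "(\<integral>\<^sup>+t. ennreal (exp (- a * t)) * indicator {c..} t \<partial>lborel) = ennreal (0 - (- exp (- a * c) / a))"
    using assms by (intro nn_integral_FTC_atLeast) (auto intro!: derivative_eq_intros, real_asymp)
  then show ?thesis by simp
qed

lemma set_integrable_exp_neg:
  fixes a :: real
  assumes "a > 0"
  shows "set_integrable lborel {0..} (\<lambda>t. exp (- a * t))"
    and "(LBINT t:{0..}. exp (- a * t)) = 1 / a"
proof -
  have eq: "(\<integral>\<^sup>+t. ennreal (indicator {0..} t *\<^sub>R exp (- a * t)) \<partial>lborel) = ennreal (1 / a)"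
    using nn_integral_exp_neg[OF assms, of 0] by (simp add: mult.commute indicator_mult_ennreal)
  show "set_integrable lborel {0..} (\<lambda>t. exp (- a * t))"
    unfolding set_integrable_def by (rule integrableI_nonneg) (use eq in auto)
  show "(LBINT t:{0..}. exp (- a * t)) = 1 / a"
    unfolding set_lebesgue_integral_def by (rule integral_eq_nn_integral[THEN trans]) (use eq assms in auto)
qed

lemma set_integrable_exp_bound:
  fixes f :: "real \<Rightarrow> real"
  assumes meas: "set_borel_measurable borel {0..} f"
    and bound: "\<And>t. t \<ge> 0 \<Longrightarrow> \<bar>f t\<bar> \<le> C * exp (a * t)" and "a < \<theta>"
  shows "set_integrable lborel {0..} (\<lambda>t. exp (- \<theta> * t) * f t)"
proof -
  have "set_integrable lborel {0..} (\<lambda>t. C * exp (- (\<theta> - a) * t))"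
    using set_integrable_exp_neg(1)[of "\<theta> - a"] assms by simp
  then show ?thesis
    unfolding set_integrable_def
  proof (rule Bochner_Integration.integrable_bound)
    have "(\<lambda>t. exp (- \<theta> * t) * (indicator {0..} t *\<^sub>R f t)) \<in> borel_measurable lborel"
      using meas unfolding set_borel_measurable_def by measurable
    then show "(\<lambda>t. indicator {0..} t *\<^sub>R (exp (- \<theta> * t) * f t)) \<in> borel_measurable lborel"
      by (simp add: mult.left_commute)
    have "exp (- \<theta> * t) * \<bar>f t\<bar> \<le> \<bar>C * exp (- (\<theta> - a) * t)\<bar>" if "t \<ge> 0" for t
    proof -
      have "exp (- \<theta> * t) * \<bar>f t\<bar> \<le> exp (- \<theta> * t) * (C * exp (a * t))"
        using bound[OF that] by (intro mult_left_mono) auto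
      also have "\<dots> = C * exp (- (\<theta> - a) * t)" by (simp add: algebra_simps exp_add[symmetric])
      finally show ?thesis by linarith
    qed
    then show "AE t in lborel. norm (indicator {0..} t *\<^sub>R (exp (- \<theta> * t) * f t))
       \<le> norm (indicator {0..} t *\<^sub>R (C * exp (- (\<theta> - a) * t)))"
      by (intro AE_I2) (auto simp: indicator_def abs_mult)
  qed
qed

text \<open>With \<open>k t = exp (- (a + 1) * t) * f t\<close>, all moments of \<open>k\<close> against powers of \<open>exp (- t)\<close> vanish;
  approximating \<open>k\<close>, as a function of \<open>exp (- t)\<close>, by polynomials gives that the integral of \<open>k * k\<close> is 0.\<close>

lemma Laplace_uniqueness:
  fixes f :: "real \<Rightarrow> real"
  assumes cont: "continuous_on {0..} f"
    and bound: "\<And>t. t \<ge> 0 \<Longrightarrow> \<bar>f t\<bar> \<le> C * exp (a * t)"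
    and Laplace: "\<And>\<theta>. \<theta> > a \<Longrightarrow> (LBINT t:{0..}. exp (- \<theta> * t) * f t) = 0"
    and "t \<ge> 0"
  shows "f t = 0"
proof -
  have meas: "set_borel_measurable borel {0..} f"
    using cont by (intro borel_measurable_continuous_on_indicator[folded set_borel_measurable_def, of "{0..}"]) auto
  \<comment> \<open>The exponent exceeds the growth rate by 1. Thus \<open>h\<close> decays like
    \<open>exp (- t)\<close>, and the moment of order \<open>n\<close> is the transform of
    \<open>f\<close> at \<open>a + 1 + n\<close>, which lies in the assumed range already for
    \<open>n = 0\<close>.\<close>
  define h where "h = (\<lambda>t. exp (- (a + 1) * t) * f t)"
  define k where "k = (\<lambda>t. indicator {0..} t * h t)"
  have C0: "C \<ge> 0" using bound[of 0] by simp
  have h_bound: "\<bar>h t\<bar> \<le> C * exp (- t)" if "t \<ge> 0" for t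
  proof -
    have "\<bar>h t\<bar> \<le> exp (- (a + 1) * t) * (C * exp (a * t))"
      using bound[OF that] unfolding h_def abs_mult by (auto intro!: mult_mono)
    also have "\<dots> = C * exp (- t)" by (simp add: algebra_simps exp_add[symmetric])
    finally show ?thesis .
  qed
  have h_cont: "continuous_on {0..} h"
    unfolding h_def by (intro continuous_intros cont)
  have k_int: "integrable lborel k"
    using set_integrable_exp_bound[OF meas bound, of "a + 1"]
    by (simp add: set_integrable_def k_def h_def)
  have k_mom: "integrable lborel (\<lambda>t. k t * exp (- t) ^ n)"
    "(LBINT t. k t * exp (- t) ^ n) = 0" for n
  proof -
    have eq: "k t * exp (- t) ^ n = indicator {0..} t *\<^sub>R (exp (- (a + 1 + n) * t) * f t)" for t
      by (simp add: k_def h_def algebra_simps exp_of_nat_mult[symmetric] exp_add[symmetric] exp_diff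
          exp_minus field_simps)
    show "integrable lborel (\<lambda>t. k t * exp (- t) ^ n)"
      unfolding eq using set_integrable_exp_bound[OF meas bound, of "a + 1 + n"]
      by (simp add: set_integrable_def)
    show "(LBINT t. k t * exp (- t) ^ n) = 0"
      unfolding eq using Laplace[of "a + 1 + n"] by (simp add: set_lebesgue_integral_def)
  qed
  \<comment> \<open>The substitution \<open>x = exp (- t)\<close> turns the half-line into a compact
    interval. The value 0 at \<open>x = 0\<close> is the limit of \<open>h\<close> at infinity; the
    decay of \<open>h\<close> becomes \<open>\<bar>\<psi> x\<bar> \<le> C * x\<close>, which gives
    continuity there.\<close>
  define \<psi> where "\<psi> = (\<lambda>x. if x = 0 then 0 else h (- ln x))"
  have \<psi>_exp: "\<psi> (exp (- t)) = h t" for t by (simp add: \<psi>_def)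
  have \<psi>_cont: "continuous_on {0..1} \<psi>"
    unfolding continuous_on_eq_continuous_within
  proof
    fix x :: real assume x: "x \<in> {0..1}"
    show "continuous (at x within {0..1}) \<psi>"
    proof (cases "x = 0")
      case True
      have "(\<psi> \<longlongrightarrow> 0) (at 0 within {0..1})"
      proof (rule Lim_null_comparison)
        show "\<forall>\<^sub>F x in at 0 within {0..1}. norm (\<psi> x) \<le> C * x"
          unfolding eventually_at_filter
        proof (rule always_eventually, safe)
          fix x :: real assume "x \<noteq> 0" "x \<in> {0..1}"
          then show "norm (\<psi> x) \<le> C * x" using h_bound[of "- ln x"] by (simp add: \<psi>_def)
        qed
        show "((\<lambda>x. C * x) \<longlongrightarrow> 0) (at 0 within {0..1})"
          by (rule tendsto_eq_intros refl)+ simp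
      qed
      then show ?thesis using True by (simp add: continuous_within \<psi>_def)
    next
      case False
      have "continuous_on {0<..1} (\<lambda>x. h (- ln x))"
        by (rule continuous_on_compose2[OF h_cont]) (auto intro!: continuous_intros)
      then have "continuous_on {0<..1} \<psi>" by (rule continuous_on_eq) (auto simp: \<psi>_def)
      then have "continuous (at x within {0<..1}) \<psi>"
        using x False by (auto simp: continuous_on_eq_continuous_within)
      moreover have "at x within {0<..1} = at x within {0..1}"
        using False x by (intro at_within_nhd[of x "{0<..}"]) auto
      ultimately show ?thesis by (simp add: continuous_within)
    qed
  qed
  define I where "I = (LBINT t. \<bar>k t\<bar>)"
  \<comment> \<open>The product \<open>k * h\<close> is the square of \<open>k\<close>. Polynomials
    in \<open>exp (- t)\<close> integrate to 0 against \<open>k\<close>, so \<open>h\<close> may be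
    replaced by its approximation error, which is below \<open>e\<close>; then \<open>e\<close>
    tends to 0.\<close>
  have k2: "integrable lborel (\<lambda>t. k t * h t)" and k2_le: "\<bar>LBINT t. k t * h t\<bar> \<le> e * I" if "e > 0" for e
  proof -
    show "integrable lborel (\<lambda>t. k t * h t)"
    proof (rule Bochner_Integration.integrable_bound)
      show "integrable lborel (\<lambda>t. C * k t)" using k_int by simp
      have "(\<lambda>t. k t * k t) \<in> borel_measurable lborel" using k_int by measurable
      then show "(\<lambda>t. k t * h t) \<in> borel_measurable lborel"
        by (rule measurable_cong[THEN iffD1, rotated]) (simp add: k_def indicator_def)
      have "\<bar>h t\<bar> \<le> C" if "t \<ge> 0" for t
        using h_bound[OF that] C0 that by (meson exp_le_one_iff le_minus_iff mult_left_le neg_le_0_iff_le order_trans)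
      then show "AE t in lborel. norm (k t * h t) \<le> norm (C * k t)"
        using C0 by (intro AE_I2) (simp add: k_def indicator_def abs_mult mult_right_mono del: abs_mult_self_eq)
    qed
    obtain g where g: "real_polynomial_function g" "\<And>x. x \<in> {0..1} \<Longrightarrow> \<bar>\<psi> x - g x\<bar> < e"
      using Stone_Weierstrass_real_polynomial_function[OF _ \<psi>_cont \<open>e > 0\<close>] by auto
    obtain c n where gc: "g = (\<lambda>x. \<Sum>i\<le>n. c i * x ^ i)"
      using g(1) by (auto simp: real_polynomial_function_iff_sum)
    have kg: "k t * g (exp (- t)) = (\<Sum>i\<le>n. c i * (k t * exp (- t) ^ i))" for t
      by (simp add: gc sum_distrib_left mult.left_commute)
    have ig: "integrable lborel (\<lambda>t. k t * g (exp (- t)))" unfolding kg by (simp add: k_mom del: power_eq_0_iff)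
    have "(LBINT t. k t * g (exp (- t))) = 0" unfolding kg by (simp add: k_mom)
    then have "(LBINT t. k t * h t) = (LBINT t. k t * h t - k t * g (exp (- t)))"
      using ig \<open>integrable lborel (\<lambda>t. k t * h t)\<close> by simp
    also have "\<bar>\<dots>\<bar> \<le> (LBINT t. e * \<bar>k t\<bar>)"
    proof (rule order_trans[OF integral_abs_bound], rule integral_mono)
      show "integrable lborel (\<lambda>t. \<bar>k t * h t - k t * g (exp (- t))\<bar>)"
        using ig \<open>integrable lborel (\<lambda>t. k t * h t)\<close> by simp
      show "integrable lborel (\<lambda>t. e * \<bar>k t\<bar>)" using k_int by simp
      fix t :: real
      show "\<bar>k t * h t - k t * g (exp (- t))\<bar> \<le> e * \<bar>k t\<bar>"
      proof (cases "t \<ge> 0")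
        case True
        then have "\<bar>h t - g (exp (- t))\<bar> \<le> e" using g(2)[of "exp (- t)"] by (simp add: \<psi>_exp)
        then have "\<bar>k t\<bar> * \<bar>h t - g (exp (- t))\<bar> \<le> \<bar>k t\<bar> * e" by (intro mult_left_mono) auto
        then show ?thesis by (simp add: abs_mult[symmetric] algebra_simps)
      qed (simp add: k_def)
    qed
    finally show "\<bar>LBINT t. k t * h t\<bar> \<le> e * I" by (simp add: I_def)
  qed
  have "((\<lambda>e. e * I) \<longlongrightarrow> 0) (at_right 0)" by (rule tendsto_eq_intros refl)+ simp
  then have "\<bar>LBINT t. k t * h t\<bar> \<le> 0"
    by (rule tendsto_lowerbound) (auto simp: eventually_at_filter k2_le)
  then have "(LBINT t. k t * h t) = 0" by simp
  then have "AE t in lborel. k t * h t = 0"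
    using k2[of 1] by (subst (asm) integral_nonneg_eq_0_iff_AE) (auto simp: k_def indicator_def)
  then have "AE t in lborel. t \<notin> {t. t > 0 \<and> h t \<noteq> 0}"
    by (rule AE_mp) (auto simp: k_def)
  \<comment> \<open>An open null set is empty, so the almost-everywhere statement holds at every
    positive time; time 0 follows by continuity.\<close>
  moreover have op: "open {t. t > 0 \<and> h t \<noteq> 0}"
  proof -
    have "open ({0<..} \<inter> h -` (- {0}))"
      by (intro continuous_open_preimage continuous_on_subset[OF h_cont]) auto
    then show ?thesis by (simp add: vimage_def Int_def)
  qed
  ultimately have "emeasure lborel {t. t > 0 \<and> h t \<noteq> 0} = 0"
    by (subst AE_iff_measurable[symmetric]) auto
  then have "{t. t > 0 \<and> h t \<noteq> 0} = {}"
    using op open_not_negligible negligible_iff_null_sets by (metis null_setsI null_sets_completionI borel_open sets_lborel)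
  then have "h t = 0" if "t \<in> {0<..}" for t using that by blast
  then have "h t = 0"
    by (rule continuous_constant_on_closure[of "{0<..}" h, rotated]) (use h_cont \<open>t \<ge> 0\<close> in auto)
  then show ?thesis by (simp add: h_def)
qed

section \<open>The inverse Gaussian Levy measure\<close>

definition ig_exponent :: "real \<Rightarrow> real \<Rightarrow> real \<Rightarrow> real" where
  "ig_exponent \<delta> \<gamma> \<theta> = \<delta> * (sqrt (2 * \<theta> + \<gamma>\<^sup>2) - \<gamma>)"

definition ig_density :: "real \<Rightarrow> real \<Rightarrow> real \<Rightarrow> real" where
  "ig_density \<delta> \<gamma> x = \<delta> / sqrt (2 * pi * x ^ 3) * exp (- \<gamma>\<^sup>2 * x / 2) * indicator {0<..} x"

lemma ig_exponent_pos:
  assumes "\<delta> > 0" "\<theta> > 0" shows "ig_exponent \<delta> \<gamma> \<theta> > 0"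
  using assms by (simp add: ig_exponent_def real_less_rsqrt)

lemma ig_density_measurable [measurable]: "ig_density \<delta> \<gamma> \<in> borel_measurable borel"
  unfolding ig_density_def by measurable

lemma ig_density_nonneg: "\<delta> \<ge> 0 \<Longrightarrow> 0 \<le> ig_density \<delta> \<gamma> x"
  by (simp add: ig_density_def indicator_def)

text \<open>The power \<open>- 3 / 2\<close> of \<open>x\<close> is split so that a factor
  \<open>1 / x\<close> is available for \<open>1 - exp (- \<theta> * x)\<close>, while the power
  \<open>- 1 / 2\<close> remains for a Gamma integral.\<close>

lemma ig_density_eq:
  "x > 0 \<Longrightarrow> ig_density \<delta> \<gamma> x = \<delta> / sqrt (2 * pi) * (x powr (- 1 / 2) * (exp (- (\<gamma>\<^sup>2 / 2) * x) / x))"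
  by (simp add: ig_density_def real_sqrt_mult power3_eq_cube powr_minus powr_half_sqrt divide_simps)

text \<open>Euler's integral for the Gamma function at 1/2, rescaled by
  \<open>t = y * x\<close>.\<close>

lemma nn_integral_Gamma_half:
  fixes y :: real
  assumes "y > 0"
  shows "(\<integral>\<^sup>+x. ennreal (indicator {0<..} x * (x powr (- 1 / 2) * exp (- y * x))) \<partial>lborel) = ennreal (sqrt pi / sqrt y)"
proof -
  have "ennreal (sqrt pi) = (\<integral>\<^sup>+t. ennreal (indicator {0..} t * t powr (1 / 2 - 1) / exp t) \<partial>lborel)"
    using Gamma_conv_nn_integral_real[of "1 / 2"] by (simp add: Gamma_one_half_real)
  also have "\<dots> = ennreal y * (\<integral>\<^sup>+x. ennreal (indicator {0..} (y * x) * (y * x) powr (1 / 2 - 1) / exp (y * x)) \<partial>lborel)"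
    using assms by (subst nn_integral_real_affine[where c = y and t = 0]) auto
  \<comment> \<open>Passing from \<open>{0..}\<close> to \<open>{0<..}\<close> is exact: a power of
    base 0 is 0 by convention, so the integrand vanishes at the origin.\<close>
  also have "\<dots> = ennreal y * (\<integral>\<^sup>+x. ennreal (y powr (- 1 / 2)) *
      ennreal (indicator {0<..} x * (x powr (- 1 / 2) * exp (- y * x))) \<partial>lborel)"
    using assms by (intro arg_cong2[where f = "(*)"] refl nn_integral_cong)
      (auto simp: indicator_def powr_mult exp_minus field_simps zero_le_mult_iff ennreal_mult[symmetric])
  also have "\<dots> = ennreal (sqrt y) *
      (\<integral>\<^sup>+x. ennreal (indicator {0<..} x * (x powr (- 1 / 2) * exp (- y * x))) \<partial>lborel)"
    using assms by (subst nn_integral_cmult)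
      (auto simp: mult.assoc[symmetric] ennreal_mult[symmetric] powr_minus powr_half_sqrt real_div_sqrt divide_inverse[symmetric])
  finally have eq: "ennreal (sqrt pi) = \<dots>" .
  have "ennreal (sqrt pi / sqrt y) = ennreal (inverse (sqrt y)) * ennreal (sqrt pi)"
    using assms by (simp add: ennreal_mult[symmetric] field_simps)
  also have "\<dots> = (\<integral>\<^sup>+x. ennreal (indicator {0<..} x * (x powr (- 1 / 2) * exp (- y * x))) \<partial>lborel)"
    unfolding eq using assms by (simp add: mult.assoc[symmetric] ennreal_mult[symmetric])
  finally show ?thesis by simp
qed

text \<open>Tonelli, after writing \<open>(1 - exp (- \<theta> * x)) / x * exp (- c * x)\<close> as the integral of \<open>exp (- y * x)\<close>
  over \<open>y\<close> from \<open>c\<close> to \<open>c + \<theta>\<close>.\<close>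

lemma nn_integral_ig_density_exponent:
  assumes "\<delta> > 0" "\<gamma> > 0" "\<theta> > 0"
  shows "(\<integral>\<^sup>+x. ennreal (ig_density \<delta> \<gamma> x * (1 - exp (- \<theta> * x))) \<partial>lborel) = ennreal (ig_exponent \<delta> \<gamma> \<theta>)"
proof -
  define c K where "c = \<gamma>\<^sup>2 / 2" and "K = \<delta> / sqrt (2 * pi)"
  have c: "c > 0" and K: "K > 0" using assms by (auto simp: c_def K_def)
  have "(\<integral>\<^sup>+x. ennreal (ig_density \<delta> \<gamma> x * (1 - exp (- \<theta> * x))) \<partial>lborel)
    = (\<integral>\<^sup>+x. (\<integral>\<^sup>+y. ennreal K * (indicator {c..c + \<theta>} y *
        ennreal (indicator {0<..} x * (x powr (- 1 / 2) * exp (- y * x)))) \<partial>lborel) \<partial>lborel)"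
  proof (intro nn_integral_cong)
    fix x :: real
    show "ennreal (ig_density \<delta> \<gamma> x * (1 - exp (- \<theta> * x))) =
      (\<integral>\<^sup>+y. ennreal K * (indicator {c..c + \<theta>} y *
        ennreal (indicator {0<..} x * (x powr (- 1 / 2) * exp (- y * x)))) \<partial>lborel)"
    proof (cases "x > 0")
      case True
      have "(\<integral>\<^sup>+y. ennreal (exp (- y * x)) * indicator {c..c + \<theta>} y \<partial>lborel)
          = ennreal ((- exp (- (c + \<theta>) * x) / x) - (- exp (- c * x) / x))"
        using True assms by (intro nn_integral_FTC_Icc[where F = "\<lambda>y. - exp (- y * x) / x"])
          (auto intro!: derivative_eq_intros simp: has_real_derivative_iff_has_vector_derivative[symmetric])
      also have "(- exp (- (c + \<theta>) * x) / x) - (- exp (- c * x) / x) = exp (- c * x) / x * (1 - exp (- \<theta> * x))"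
        by (simp add: diff_divide_distrib[symmetric] algebra_simps exp_add[symmetric])
      finally have "(\<integral>\<^sup>+y. ennreal (K * x powr (- 1 / 2)) * (ennreal (exp (- y * x)) * indicator {c..c + \<theta>} y) \<partial>lborel)
         = ennreal (K * x powr (- 1 / 2)) * ennreal (exp (- c * x) / x * (1 - exp (- \<theta> * x)))"
        by (subst nn_integral_cmult) auto
      also have "\<dots> = ennreal (ig_density \<delta> \<gamma> x * (1 - exp (- \<theta> * x)))"
        using True K assms by (subst ennreal_mult[symmetric]) (auto simp: ig_density_eq c_def K_def mult.assoc)
      finally show ?thesis using True K
        by (simp add: ennreal_mult mult_ac)
    qed (simp add: ig_density_def)
  qed
  also have "\<dots> = (\<integral>\<^sup>+y. (\<integral>\<^sup>+x. ennreal K * (indicator {c..c + \<theta>} y *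
        ennreal (indicator {0<..} x * (x powr (- 1 / 2) * exp (- y * x)))) \<partial>lborel) \<partial>lborel)"
    by (rule lborel_pair.Fubini') measurable
  also have "\<dots> = (\<integral>\<^sup>+y. ennreal (K * sqrt pi * (1 / sqrt y)) * indicator {c..c + \<theta>} y \<partial>lborel)"
  proof (intro nn_integral_cong)
    fix y :: real
    show "(\<integral>\<^sup>+x. ennreal K * (indicator {c..c + \<theta>} y *
        ennreal (indicator {0<..} x * (x powr (- 1 / 2) * exp (- y * x)))) \<partial>lborel) =
        ennreal (K * sqrt pi * (1 / sqrt y)) * indicator {c..c + \<theta>} y"
    proof (cases "y \<in> {c..c + \<theta>}")
      case True
      then have y: "y > 0" using c by auto
      have "(\<integral>\<^sup>+x. ennreal K * ennreal (indicator {0<..} x * (x powr (- 1 / 2) * exp (- y * x))) \<partial>lborel)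
          = ennreal K * ennreal (sqrt pi / sqrt y)"
        unfolding nn_integral_Gamma_half[OF y, symmetric] by (rule nn_integral_cmult) measurable
      then show ?thesis using True y K by (simp add: ennreal_mult[symmetric])
    qed simp
  qed
  \<comment> \<open>The inner Gamma integral has left \<open>1 / sqrt y\<close>, with primitive
    \<open>2 * sqrt y\<close>: this is where the square root of the exponent comes from. Positivity
    of \<open>c\<close> keeps the interval away from 0.\<close>
  also have "\<dots> = ennreal (K * sqrt pi * 2 * sqrt (c + \<theta>) - K * sqrt pi * 2 * sqrt c)"
    using assms c K by (intro nn_integral_FTC_Icc)
      (auto intro!: derivative_eq_intros simp: has_real_derivative_iff_has_vector_derivative[symmetric] field_simps)
  also have "K * sqrt pi * 2 * sqrt (c + \<theta>) - K * sqrt pi * 2 * sqrt c = ig_exponent \<delta> \<gamma> \<theta>"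
  proof -
    have "sqrt c = \<gamma> / sqrt 2" using assms by (simp add: c_def real_sqrt_divide)
    moreover have "sqrt (c + \<theta>) = sqrt (2 * \<theta> + \<gamma>\<^sup>2) / sqrt 2"
      by (simp add: c_def real_sqrt_divide[symmetric] add_divide_distrib add.commute)
    moreover have "K * sqrt pi * 2 = \<delta> * sqrt 2"
      by (simp add: K_def real_sqrt_mult field_simps)
    ultimately show ?thesis by (simp add: ig_exponent_def algebra_simps)
  qed
  finally show ?thesis .
qed

lemma emeasure_ig_levy_measure:
  "emeasure (ig_levy_measure \<delta> \<gamma>) {s<..} = (\<integral>\<^sup>+x. ennreal (ig_density \<delta> \<gamma> x) * indicator {s<..} x \<partial>lborel)"
  unfolding ig_levy_measure_def ig_density_def by (subst emeasure_density) auto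

text \<open>Beyond \<open>s\<close> the factor \<open>1 - exp (- x)\<close> is at least
  \<open>1 - exp (- s) > 0\<close>, and the density weighted with it has the finite integral
  \<open>ig_exponent \<delta> \<gamma> 1\<close>.\<close>

lemma set_integrable_ig_density:
  assumes "\<delta> > 0" "\<gamma> > 0" "s > 0"
  shows "set_integrable lborel {s<..} (ig_density \<delta> \<gamma>)"
  unfolding set_integrable_def
proof (rule Bochner_Integration.integrable_bound)
  show "integrable lborel (\<lambda>x. ig_density \<delta> \<gamma> x * (1 - exp (- 1 * x)) / (1 - exp (- s)))"
    using nn_integral_ig_density_exponent[OF assms(1,2), of 1] ig_density_nonneg[of \<delta> \<gamma>] assms
    by (intro integrable_divide integrableI_nonneg) (auto simp: ig_density_def indicator_def intro!: AE_I2)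
  show "AE x in lborel. norm (indicator {s<..} x *\<^sub>R ig_density \<delta> \<gamma> x)
      \<le> norm (ig_density \<delta> \<gamma> x * (1 - exp (- 1 * x)) / (1 - exp (- s)))"
  proof (intro AE_I2)
    fix x
    have "ig_density \<delta> \<gamma> x * (1 - exp (- s)) \<le> ig_density \<delta> \<gamma> x * (1 - exp (- x))" if "x > s"
      using ig_density_nonneg[of \<delta> \<gamma> x] assms that by (intro mult_left_mono) auto
    then show "norm (indicator {s<..} x *\<^sub>R ig_density \<delta> \<gamma> x)
      \<le> norm (ig_density \<delta> \<gamma> x * (1 - exp (- 1 * x)) / (1 - exp (- s)))"
      using ig_density_nonneg[of \<delta> \<gamma> x] assms
      by (auto simp: indicator_def field_simps abs_mult)
  qed
qed measurable

text \<open>For positive \<open>s\<close> the mass beyond \<open>s\<close> is finite, so the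
  real-valued \<open>measure\<close> in the tail is the true value and not the default 0.\<close>

lemma ennreal_ig_levy_tail:
  assumes "\<delta> > 0" "\<gamma> > 0" "s > 0"
  shows "ennreal (ig_levy_tail \<delta> \<gamma> s) = (\<integral>\<^sup>+x. ennreal (ig_density \<delta> \<gamma> x) * indicator {s<..} x \<partial>lborel)"
    and "ig_levy_tail \<delta> \<gamma> s = (LBINT x:{s<..}. ig_density \<delta> \<gamma> x)"
proof -
  have "(\<integral>\<^sup>+x. ennreal (ig_density \<delta> \<gamma> x) * indicator {s<..} x \<partial>lborel)
     = (\<integral>\<^sup>+x. ennreal (indicator {s<..} x *\<^sub>R ig_density \<delta> \<gamma> x) \<partial>lborel)"
    by (intro nn_integral_cong) (auto simp: indicator_def)
  also have "\<dots> = ennreal (LBINT x:{s<..}. ig_density \<delta> \<gamma> x)"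
    unfolding set_lebesgue_integral_def using set_integrable_ig_density[OF assms] assms ig_density_nonneg
    by (intro nn_integral_eq_integral) (auto simp: set_integrable_def)
  finally have eq: "(\<integral>\<^sup>+x. ennreal (ig_density \<delta> \<gamma> x) * indicator {s<..} x \<partial>lborel) =
     ennreal (LBINT x:{s<..}. ig_density \<delta> \<gamma> x)" .
  have "0 \<le> (LBINT x:{s<..}. ig_density \<delta> \<gamma> x)"
    unfolding set_lebesgue_integral_def using assms ig_density_nonneg by (intro integral_nonneg_AE) auto
  then show eq': "ig_levy_tail \<delta> \<gamma> s = (LBINT x:{s<..}. ig_density \<delta> \<gamma> x)"
    unfolding ig_levy_tail_def measure_def emeasure_ig_levy_measure eq by simp
  show "ennreal (ig_levy_tail \<delta> \<gamma> s) = (\<integral>\<^sup>+x. ennreal (ig_density \<delta> \<gamma> x) * indicator {s<..} x \<partial>lborel)"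
    by (simp add: eq eq')
qed

lemma ig_levy_tail_nonneg [simp]: "0 \<le> ig_levy_tail \<delta> \<gamma> s"
  by (simp add: ig_levy_tail_def)

lemma ig_levy_tail_measurable [measurable]: "ig_levy_tail \<delta> \<gamma> \<in> borel_measurable borel"
proof -
  have "ig_levy_tail \<delta> \<gamma> = (\<lambda>s. enn2real (\<integral>\<^sup>+x. ennreal (ig_density \<delta> \<gamma> x) * indicator {x. s < x} x \<partial>lborel))"
    by (simp add: fun_eq_iff ig_levy_tail_def measure_def emeasure_ig_levy_measure greaterThan_def[symmetric])
  then show ?thesis by simp
qed

text \<open>Dominated convergence, with the density on \<open>{s / 2<..}\<close> as majorant.
  Replacing \<open>u n\<close> by \<open>max (u n) (s / 2)\<close> makes the domination hold for
  every \<open>n\<close> and changes only finitely many terms.\<close>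

lemma isCont_ig_levy_tail:
  assumes "\<delta> > 0" "\<gamma> > 0" "s > 0"
  shows "isCont (ig_levy_tail \<delta> \<gamma>) s"
  unfolding continuous_at_sequentially
proof safe
  fix u assume u: "u \<longlonglongrightarrow> s"
  have ev: "\<forall>\<^sub>F n in sequentially. u n > s / 2" using order_tendstoD(1)[OF u, of "s / 2"] assms by simp
  have "(\<lambda>n. LBINT x. indicator {max (u n) (s / 2)<..} x *\<^sub>R ig_density \<delta> \<gamma> x) \<longlonglongrightarrow>
     (LBINT x. indicator {s<..} x *\<^sub>R ig_density \<delta> \<gamma> x)"
  proof (rule integral_dominated_convergence[where w = "\<lambda>x. indicator {s / 2<..} x *\<^sub>R ig_density \<delta> \<gamma> x"])
    show "integrable lborel (\<lambda>x. indicator {s / 2<..} x *\<^sub>R ig_density \<delta> \<gamma> x)"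
      using set_integrable_ig_density[OF assms(1,2), of "s / 2"] assms by (simp add: set_integrable_def)
    have "(\<lambda>n. indicator {max (u n) (s / 2)<..} x *\<^sub>R ig_density \<delta> \<gamma> x) \<longlonglongrightarrow> indicator {s<..} x *\<^sub>R ig_density \<delta> \<gamma> x"
      if "x \<noteq> s" for x
    proof (rule tendsto_eventually)
      have "\<forall>\<^sub>F n in sequentially. (u n < x) = (s < x)"
        using that order_tendstoD[OF u, of x] by (cases "x < s") (auto elim: eventually_mono)
      then show "\<forall>\<^sub>F n in sequentially. indicator {max (u n) (s / 2)<..} x *\<^sub>R ig_density \<delta> \<gamma> x = indicator {s<..} x *\<^sub>R ig_density \<delta> \<gamma> x"
        using ev by eventually_elim (auto simp: indicator_def)
    qed
    then show "AE x in lborel. (\<lambda>n. indicator {max (u n) (s / 2)<..} x *\<^sub>R ig_density \<delta> \<gamma> x) \<longlonglongrightarrow> indicator {s<..} x *\<^sub>R ig_density \<delta> \<gamma> x"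
      using AE_lborel_singleton[of s] by (auto elim: eventually_mono)
  qed (use assms in \<open>auto simp: indicator_def ig_density_nonneg\<close>)
  moreover have "\<forall>\<^sub>F n in sequentially. (LBINT x. indicator {max (u n) (s / 2)<..} x *\<^sub>R ig_density \<delta> \<gamma> x) = ig_levy_tail \<delta> \<gamma> (u n)"
    using ev by eventually_elim (use assms in \<open>simp add: ennreal_ig_levy_tail(2) set_lebesgue_integral_def max_def\<close>)
  ultimately show "(ig_levy_tail \<delta> \<gamma> \<circ> u) \<longlonglongrightarrow> ig_levy_tail \<delta> \<gamma> s"
    using assms by (simp add: ennreal_ig_levy_tail(2)[of \<delta> \<gamma> s] set_lebesgue_integral_def o_def tendsto_cong)
qed

text \<open>Writing the tail as an integral of the density and exchanging the integrals leaves
  \<open>(1 - exp (- \<theta> * x)) / \<theta>\<close> against the density, which is the exponent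
  divided by \<open>\<theta>\<close>.\<close>

lemma Laplace_ig_levy_tail:
  assumes "\<delta> > 0" "\<gamma> > 0" "\<theta> > 0"
  shows "set_integrable lborel {0..} (\<lambda>s. exp (- \<theta> * s) * ig_levy_tail \<delta> \<gamma> s)"
    and "(LBINT s:{0..}. exp (- \<theta> * s) * ig_levy_tail \<delta> \<gamma> s) = ig_exponent \<delta> \<gamma> \<theta> / \<theta>"
proof -
  have "(\<integral>\<^sup>+s. ennreal (indicator {0..} s *\<^sub>R (exp (- \<theta> * s) * ig_levy_tail \<delta> \<gamma> s)) \<partial>lborel)
    = (\<integral>\<^sup>+s. (\<integral>\<^sup>+x. ennreal (ig_density \<delta> \<gamma> x) * (ennreal (exp (- \<theta> * s)) * indicator {0<..} s * indicator {s<..} x) \<partial>lborel) \<partial>lborel)"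
  \<comment> \<open>The point \<open>s = 0\<close> is discarded as a null set: there the tail is a
    default value and not an integral of the density.\<close>
  proof (rule nn_integral_cong_AE, use AE_lborel_singleton[of "0 :: real"] in \<open>rule AE_mp\<close>, intro AE_I2 impI)
    fix s :: real assume "s \<noteq> 0"
    show "ennreal (indicator {0..} s *\<^sub>R (exp (- \<theta> * s) * ig_levy_tail \<delta> \<gamma> s)) =
      (\<integral>\<^sup>+x. ennreal (ig_density \<delta> \<gamma> x) * (ennreal (exp (- \<theta> * s)) * indicator {0<..} s * indicator {s<..} x) \<partial>lborel)"
    proof (cases "s > 0")
      case True
      have "(\<integral>\<^sup>+x. ennreal (ig_density \<delta> \<gamma> x) * (ennreal (exp (- \<theta> * s)) * indicator {0<..} s * indicator {s<..} x) \<partial>lborel)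
        = (\<integral>\<^sup>+x. ennreal (exp (- \<theta> * s)) * (ennreal (ig_density \<delta> \<gamma> x) * indicator {s<..} x) \<partial>lborel)"
        using True by (intro nn_integral_cong) (simp add: mult_ac)
      also have "\<dots> = ennreal (exp (- \<theta> * s)) * ennreal (ig_levy_tail \<delta> \<gamma> s)"
        using True assms by (subst nn_integral_cmult) (auto simp: ennreal_ig_levy_tail(1))
      finally show ?thesis using True by (simp add: ennreal_mult)
    qed (use \<open>s \<noteq> 0\<close> in simp)
  qed
  \<comment> \<open>The half-line becomes a comprehension, which \<open>measurable\<close> can treat
    as a joint predicate in \<open>s\<close> and \<open>x\<close>.\<close>
  also have "\<dots> = (\<integral>\<^sup>+s. (\<integral>\<^sup>+x. ennreal (ig_density \<delta> \<gamma> x) * (ennreal (exp (- \<theta> * s)) * indicator {0<..} s * indicator {x. s < x} x) \<partial>lborel) \<partial>lborel)"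
    by (simp add: greaterThan_def)
  also have "\<dots> = (\<integral>\<^sup>+x. (\<integral>\<^sup>+s. ennreal (ig_density \<delta> \<gamma> x) * (ennreal (exp (- \<theta> * s)) * indicator {0<..} s * indicator {x. s < x} x) \<partial>lborel) \<partial>lborel)"
    by (rule lborel_pair.Fubini') measurable
  also have "\<dots> = (\<integral>\<^sup>+x. ennreal (1 / \<theta>) * ennreal (ig_density \<delta> \<gamma> x * (1 - exp (- \<theta> * x))) \<partial>lborel)"
  proof (intro nn_integral_cong)
    fix x :: real
    show "(\<integral>\<^sup>+s. ennreal (ig_density \<delta> \<gamma> x) * (ennreal (exp (- \<theta> * s)) * indicator {0<..} s * indicator {x. s < x} x) \<partial>lborel)
      = ennreal (1 / \<theta>) * ennreal (ig_density \<delta> \<gamma> x * (1 - exp (- \<theta> * x)))"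
    proof (cases "x > 0")
      case True
      have "(\<integral>\<^sup>+s. ennreal (exp (- \<theta> * s)) * indicator {0<..} s * indicator {x. s < x} x \<partial>lborel)
        = (\<integral>\<^sup>+s. ennreal (exp (- \<theta> * s)) * indicator {0..x} s \<partial>lborel)"
        by (intro nn_integral_cong_AE, use AE_lborel_singleton[of "0 :: real"] AE_lborel_singleton[of x] in eventually_elim)
          (auto simp: indicator_def)
      also have "\<dots> = ennreal (- exp (- \<theta> * x) / \<theta> - (- exp (- \<theta> * 0) / \<theta>))"
        using True assms by (intro nn_integral_FTC_Icc[where F = "\<lambda>s. - exp (- \<theta> * s) / \<theta>"])
          (auto intro!: derivative_eq_intros simp: has_real_derivative_iff_has_vector_derivative[symmetric])
      also have "\<dots> = ennreal (1 / \<theta> * (1 - exp (- \<theta> * x)))"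
        using assms by (simp add: diff_divide_distrib)
      finally have "(\<integral>\<^sup>+s. ennreal (ig_density \<delta> \<gamma> x) * (ennreal (exp (- \<theta> * s)) * indicator {0<..} s * indicator {x. s < x} x) \<partial>lborel)
        = ennreal (ig_density \<delta> \<gamma> x) * ennreal (1 / \<theta> * (1 - exp (- \<theta> * x)))"
        by (subst nn_integral_cmult) auto
      also have "\<dots> = ennreal (1 / \<theta> * (ig_density \<delta> \<gamma> x * (1 - exp (- \<theta> * x))))"
        using True assms ig_density_nonneg[of \<delta> \<gamma> x] by (subst ennreal_mult[symmetric]) (auto simp: field_simps)
      also have "\<dots> = ennreal (1 / \<theta>) * ennreal (ig_density \<delta> \<gamma> x * (1 - exp (- \<theta> * x)))"
        using True assms ig_density_nonneg[of \<delta> \<gamma> x] by (intro ennreal_mult) auto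
      finally show ?thesis .
    qed (simp add: ig_density_def)
  qed
  also have "\<dots> = ennreal (1 / \<theta>) * ennreal (ig_exponent \<delta> \<gamma> \<theta>)"
    using nn_integral_ig_density_exponent[OF assms] by (subst nn_integral_cmult) auto
  also have "\<dots> = ennreal (ig_exponent \<delta> \<gamma> \<theta> / \<theta>)"
    using assms ig_exponent_pos[of \<delta> \<theta> \<gamma>] by (simp add: ennreal_mult[symmetric])
  finally have eq: "(\<integral>\<^sup>+s. ennreal (indicator {0..} s *\<^sub>R (exp (- \<theta> * s) * ig_levy_tail \<delta> \<gamma> s)) \<partial>lborel)
    = ennreal (ig_exponent \<delta> \<gamma> \<theta> / \<theta>)" .
  show "set_integrable lborel {0..} (\<lambda>s. exp (- \<theta> * s) * ig_levy_tail \<delta> \<gamma> s)"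
    unfolding set_integrable_def by (rule integrableI_nonneg) (use eq in auto)
  show "(LBINT s:{0..}. exp (- \<theta> * s) * ig_levy_tail \<delta> \<gamma> s) = ig_exponent \<delta> \<gamma> \<theta> / \<theta>"
    unfolding set_lebesgue_integral_def
    by (rule integral_eq_nn_integral[THEN trans]) (use eq assms ig_exponent_pos[of \<delta> \<theta> \<gamma>] in auto)
qed

section \<open>The Caputo-Djrbashian derivative and Laplace transforms\<close>

text \<open>After multiplication by the exponential weight and extension by 0, both factors are
  integrable on the whole line, and the claim is Fubini with translation invariance. The weights
  multiply to \<open>exp (- \<theta> * t)\<close>, and the two indicators confine \<open>s\<close>
  to \<open>{0..t}\<close>.\<close>

lemma Laplace_convolution:
  fixes f k :: "real \<Rightarrow> real"
  assumes f: "set_integrable lborel {0..} (\<lambda>s. exp (- \<theta> * s) * f s)"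
    and k: "set_integrable lborel {0..} (\<lambda>s. exp (- \<theta> * s) * k s)"
  shows "(LBINT t:{0..}. exp (- \<theta> * t) * (LBINT s:{0..t}. f s * k (t - s))) =
    (LBINT s:{0..}. exp (- \<theta> * s) * f s) * (LBINT s:{0..}. exp (- \<theta> * s) * k s)"
proof -
  define F where "F = (\<lambda>s. indicator {0..} s *\<^sub>R (exp (- \<theta> * s) * f s))"
  define K where "K = (\<lambda>s. indicator {0..} s *\<^sub>R (exp (- \<theta> * s) * k s))"
  have F: "integrable lborel F" and K: "integrable lborel K"
    using f k by (auto simp: set_integrable_def F_def K_def)
  have [measurable]: "F \<in> borel_measurable borel" "K \<in> borel_measurable borel"
    using F K borel_measurable_integrable by auto
  have K_shift: "integrable lborel (\<lambda>t. K (t - s))" "(LBINT t. K (t - s)) = integral\<^sup>L lborel K" for s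
    using lborel_integrable_real_affine[OF K, of 1 "-s"] lborel_integral_real_affine[of 1 K "-s"]
    by (simp_all add: algebra_simps)
  have int: "integrable (lborel \<Otimes>\<^sub>M lborel) (\<lambda>(s, t). F s * K (t - s))"
  proof (rule lborel_pair.Fubini_integrable)
    have "(\<lambda>s. LBINT t. norm (F s * K (t - s))) = (\<lambda>s. \<bar>F s\<bar> * (LBINT t. \<bar>K t\<bar>))"
    proof
      fix s show "(LBINT t. norm (F s * K (t - s))) = \<bar>F s\<bar> * (LBINT t. \<bar>K t\<bar>)"
        using lborel_integral_real_affine[of 1 "\<lambda>t. \<bar>K t\<bar>" "-s"] by (simp add: abs_mult)
    qed
    then show "integrable lborel (\<lambda>s. LBINT t. norm (case (s, t) of (s, t) \<Rightarrow> F s * K (t - s)))"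
      using F by simp
    show "AE s in lborel. integrable lborel (\<lambda>t. case (s, t) of (s, t) \<Rightarrow> F s * K (t - s))"
      using K_shift(1) by simp
  qed measurable
  have "(LBINT t:{0..}. exp (- \<theta> * t) * (LBINT s:{0..t}. f s * k (t - s))) = (LBINT t. LBINT s. F s * K (t - s))"
    unfolding set_lebesgue_integral_def[of _ "{0..}"]
  proof (intro Bochner_Integration.integral_cong refl)
    fix t :: real
    have eq: "F s * K (t - s) = indicator {0..} t * exp (- \<theta> * t) * (indicator {0..t} s *\<^sub>R (f s * k (t - s)))" for s
    proof -
      have "exp (- \<theta> * s) * exp (- \<theta> * (t - s)) = exp (- \<theta> * t)" by (simp add: exp_add[symmetric] algebra_simps)
      then show ?thesis by (auto simp: F_def K_def indicator_def mult_ac)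
    qed
    show "indicator {0..} t *\<^sub>R (exp (- \<theta> * t) * (LBINT s:{0..t}. f s * k (t - s))) = (LBINT s. F s * K (t - s))"
      unfolding eq integral_mult_right_zero by (simp add: set_lebesgue_integral_def)
  qed
  also have "\<dots> = (LBINT s. LBINT t. F s * K (t - s))"
    using lborel_pair.Fubini_integral[OF int] by simp
  also have "\<dots> = (LBINT s. F s) * (LBINT s. K s)"
    using K_shift(2) by simp
  finally show ?thesis by (simp add: F_def K_def set_lebesgue_integral_def)
qed

text \<open>Local integrability at 0 is extracted from the transform at \<open>\<theta> = 1\<close>,
  since \<open>1 \<le> exp (t - s)\<close> for \<open>s \<le> t\<close>. This is the origin of the
  growth \<open>exp t\<close> and of the constant
  \<open>ig_exponent \<delta> \<gamma> 1\<close>.\<close>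

lemma set_integrable_ig_levy_tail:
  assumes "\<delta> > 0" "\<gamma> > 0" "a \<ge> 0"
  shows "set_integrable lborel {a..t} (ig_levy_tail \<delta> \<gamma>)"
    and "t \<ge> 0 \<Longrightarrow> (LBINT s:{0..t}. ig_levy_tail \<delta> \<gamma> s) \<le> exp t * ig_exponent \<delta> \<gamma> 1"
proof -
  have int: "integrable lborel (\<lambda>s. exp t * (indicator {0..} s *\<^sub>R (exp (- 1 * s) * ig_levy_tail \<delta> \<gamma> s)))"
    using Laplace_ig_levy_tail(1)[OF assms(1,2), of 1] by (auto simp: set_integrable_def)
  have le: "indicator {0..t} s * ig_levy_tail \<delta> \<gamma> s \<le>
       exp t * (indicator {0..} s *\<^sub>R (exp (- 1 * s) * ig_levy_tail \<delta> \<gamma> s))" for s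
  proof -
    have "1 * ig_levy_tail \<delta> \<gamma> s \<le> exp (t - s) * ig_levy_tail \<delta> \<gamma> s" if "s \<le> t"
      using that by (intro mult_right_mono) auto
    then show ?thesis by (auto simp: indicator_def exp_diff exp_minus field_simps)
  qed
  have 0: "set_integrable lborel {0..t} (ig_levy_tail \<delta> \<gamma>)"
    unfolding set_integrable_def
  proof (rule Bochner_Integration.integrable_bound[OF int])
    show "AE s in lborel. norm (indicator {0..t} s *\<^sub>R ig_levy_tail \<delta> \<gamma> s)
        \<le> norm (exp t * (indicator {0..} s *\<^sub>R (exp (- 1 * s) * ig_levy_tail \<delta> \<gamma> s)))"
      using le by (intro AE_I2) (auto simp: indicator_def abs_mult)
  qed measurable
  then show "set_integrable lborel {a..t} (ig_levy_tail \<delta> \<gamma>)"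
    by (rule set_integrable_subset) (use assms in auto)
  show "(LBINT s:{0..t}. ig_levy_tail \<delta> \<gamma> s) \<le> exp t * ig_exponent \<delta> \<gamma> 1" if "t \<ge> 0"
  proof -
    have "(LBINT s:{0..t}. ig_levy_tail \<delta> \<gamma> s) \<le>
        (LBINT s. exp t * (indicator {0..} s *\<^sub>R (exp (- 1 * s) * ig_levy_tail \<delta> \<gamma> s)))"
      unfolding set_lebesgue_integral_def using int 0 le
      by (intro integral_mono) (auto simp: set_integrable_def)
    also have "\<dots> = exp t * ig_exponent \<delta> \<gamma> 1"
      using Laplace_ig_levy_tail(2)[OF assms(1,2), of 1] by (simp add: set_lebesgue_integral_def)
    finally show ?thesis .
  qed
qed

lemma integral_has_derivative_interior:
  fixes f :: "real \<Rightarrow> real"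
  assumes "continuous_on {a..} f" "a < t"
  shows "((\<lambda>u. LBINT s:{a..u}. f s) has_field_derivative f t) (at t)"
proof -
  have eq: "(LBINT s:{a..u}. f s) = integral {a..u} f" for u
    by (intro set_borel_integral_eq_integral(2) borel_integrable_atLeastAtMost' continuous_on_subset[OF assms(1)]) auto
  have "((\<lambda>u. integral {a..u} f) has_real_derivative f t) (at t within {a..t + 1})"
    using assms by (intro integral_has_real_derivative continuous_on_subset[OF assms(1)]) auto
  moreover have "at t within {a..t + 1} = at t"
    using assms by (intro at_within_interior) (auto simp: interior_atLeastAtMost_real)
  ultimately show ?thesis by (simp add: eq)
qed

lemma continuous_on_atLeast_borel:
  fixes f :: "real \<Rightarrow> real"
  shows "continuous_on {a..} f \<Longrightarrow> set_borel_measurable borel {a..} f"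
  unfolding set_borel_measurable_def by (intro borel_measurable_continuous_on_indicator) auto

text \<open>The reflection \<open>s \<mapsto> t - s\<close> yields the third form, in which
  \<open>t\<close> occurs inside the continuous factor and no longer inside the singular
  tail.\<close>

lemma tail_convolution_integrable:
  assumes "\<delta> > 0" "\<gamma> > 0" and cont: "continuous_on {0..} f"
    and bound: "\<And>s. s \<ge> 0 \<Longrightarrow> \<bar>f s\<bar> \<le> C"
  shows "set_integrable lborel {0..t} (\<lambda>s. f s * ig_levy_tail \<delta> \<gamma> (t - s))"
    and "t \<ge> 0 \<Longrightarrow> \<bar>tail_convolution \<delta> \<gamma> f t\<bar> \<le> C * (exp t * ig_exponent \<delta> \<gamma> 1)"
    and "tail_convolution \<delta> \<gamma> f t = (LBINT s:{0..t}. f (t - s) * ig_levy_tail \<delta> \<gamma> s)"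
proof -
  have C: "C \<ge> 0" using bound[of 0] by simp
  have refl: "indicator {0..t} (t - s) = (indicator {0..t} s :: real)" for s
    by (auto simp: indicator_def)
  have int: "integrable lborel (\<lambda>s. C * (indicator {0..t} s *\<^sub>R ig_levy_tail \<delta> \<gamma> (t - s)))"
  proof -
    have "integrable lborel (\<lambda>s. indicator {0..t} s *\<^sub>R ig_levy_tail \<delta> \<gamma> s)"
      using set_integrable_ig_levy_tail(1)[OF assms(1,2), of 0 t] by (simp add: set_integrable_def)
    from lborel_integrable_real_affine[OF this, of "-1" t] show ?thesis by (simp add: refl)
  qed
  have le: "\<bar>indicator {0..t} s *\<^sub>R (f s * ig_levy_tail \<delta> \<gamma> (t - s))\<bar> \<le> C * (indicator {0..t} s *\<^sub>R ig_levy_tail \<delta> \<gamma> (t - s))" for s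
    using bound[of s] by (auto simp: indicator_def abs_mult mult_right_mono)
  show *: "set_integrable lborel {0..t} (\<lambda>s. f s * ig_levy_tail \<delta> \<gamma> (t - s))"
    unfolding set_integrable_def
  proof (rule Bochner_Integration.integrable_bound[OF int])
    \<comment> \<open>Continuity controls \<open>f\<close> only on the half-line, so its indicator
      is attached to \<open>f\<close> before measurability is derived.\<close>
    have "(\<lambda>s. (indicator {0..} s *\<^sub>R f s) * (indicator {0..t} s * ig_levy_tail \<delta> \<gamma> (t - s))) \<in> borel_measurable borel"
      using continuous_on_atLeast_borel[OF cont] unfolding set_borel_measurable_def by measurable
    moreover have "(indicator {0..} s *\<^sub>R f s) * (indicator {0..t} s * ig_levy_tail \<delta> \<gamma> (t - s))
        = indicator {0..t} s *\<^sub>R (f s * ig_levy_tail \<delta> \<gamma> (t - s))" for s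
      by (auto simp: indicator_def)
    ultimately show "(\<lambda>s. indicator {0..t} s *\<^sub>R (f s * ig_levy_tail \<delta> \<gamma> (t - s))) \<in> borel_measurable lborel"
      by (simp only: measurable_lborel2)
    show "AE s in lborel. norm (indicator {0..t} s *\<^sub>R (f s * ig_levy_tail \<delta> \<gamma> (t - s)))
       \<le> norm (C * (indicator {0..t} s *\<^sub>R ig_levy_tail \<delta> \<gamma> (t - s)))"
    proof (intro AE_I2)
      fix s show "norm (indicator {0..t} s *\<^sub>R (f s * ig_levy_tail \<delta> \<gamma> (t - s)))
       \<le> norm (C * (indicator {0..t} s *\<^sub>R ig_levy_tail \<delta> \<gamma> (t - s)))"
        using le[of s] unfolding real_norm_def by linarith
    qed
  qed
  show "tail_convolution \<delta> \<gamma> f t = (LBINT s:{0..t}. f (t - s) * ig_levy_tail \<delta> \<gamma> s)"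
    unfolding tail_convolution_def set_lebesgue_integral_def
    by (subst lborel_integral_real_affine[where c = "-1" and t = t]) (auto simp: refl)
  assume "t \<ge> 0"
  have "\<bar>tail_convolution \<delta> \<gamma> f t\<bar> \<le> (LBINT s. C * (indicator {0..t} s *\<^sub>R ig_levy_tail \<delta> \<gamma> (t - s)))"
    unfolding tail_convolution_def set_lebesgue_integral_def
    using int * le by (intro order_trans[OF integral_abs_bound] integral_mono) (auto simp: set_integrable_def)
  also have "\<dots> = C * (LBINT s:{0..t}. ig_levy_tail \<delta> \<gamma> s)"
    unfolding set_lebesgue_integral_def
    by (subst (2) lborel_integral_real_affine[where c = "-1" and t = t]) (auto simp: refl)
  also have "\<dots> \<le> C * (exp t * ig_exponent \<delta> \<gamma> 1)"
    using set_integrable_ig_levy_tail(2)[OF assms(1,2), of 0 t] \<open>t \<ge> 0\<close> C by (intro mult_left_mono) auto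
  finally show "\<bar>tail_convolution \<delta> \<gamma> f t\<bar> \<le> C * (exp t * ig_exponent \<delta> \<gamma> 1)" .
qed

text \<open>Because \<open>f 0 = 0\<close>, extending \<open>f\<close> by 0 to negative times is
  continuous, and the moving upper limit \<open>t\<close> can be replaced by a fixed
  \<open>B\<close>. Dominated convergence then applies, with a multiple of the tail on
  \<open>{0..B}\<close> as majorant.\<close>

lemma continuous_on_tail_convolution:
  assumes "\<delta> > 0" "\<gamma> > 0" and cont: "continuous_on {0..} f" and "f 0 = 0"
    and bound: "\<And>s. s \<ge> 0 \<Longrightarrow> \<bar>f s\<bar> \<le> C"
  shows "continuous_on {0..} (tail_convolution \<delta> \<gamma> f)"
proof -
  define f' where "f' = (\<lambda>s. f (max s 0))"
  have f'_cont: "continuous_on UNIV f'"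
    unfolding f'_def by (rule continuous_on_compose2[OF cont]) (auto intro!: continuous_intros)
  have [measurable]: "f' \<in> borel_measurable borel"
    using f'_cont by (rule borel_measurable_continuous_onI)
  have C: "C \<ge> 0" using bound[of 0] by simp
  have eq: "tail_convolution \<delta> \<gamma> f t = (LBINT s. f' (t - s) * (indicator {0..t} s * ig_levy_tail \<delta> \<gamma> s))" for t
    by (subst tail_convolution_integrable(3)[OF assms(1,2) cont bound])
      (auto simp: set_lebesgue_integral_def f'_def indicator_def intro!: Bochner_Integration.integral_cong)
  have eq': "f' (t - s) * (indicator {0..t} s * ig_levy_tail \<delta> \<gamma> s) = f' (t - s) * (indicator {0..B} s * ig_levy_tail \<delta> \<gamma> s)"
    if "t \<le> B" for s t B
    using that by (auto simp: indicator_def f'_def max_def \<open>f 0 = 0\<close>)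
  show ?thesis
    unfolding continuous_on_sequentially
  proof (intro allI ballI impI, elim conjE)
    fix u :: "nat \<Rightarrow> real" and t :: real
    assume "t \<in> {0..}" and u: "\<forall>n. u n \<in> {0..}" "u \<longlonglongrightarrow> t"
    obtain B where B: "\<And>n. u n \<le> B"
      using convergent_imp_Bseq[of u] u(2) by (auto simp: convergent_def Bseq_def) (meson abs_le_D1)
    then have "t \<le> B" using u(2) by (meson LIMSEQ_le_const2)
    have "(\<lambda>n. LBINT s. f' (u n - s) * (indicator {0..B} s * ig_levy_tail \<delta> \<gamma> s)) \<longlonglongrightarrow>
        (LBINT s. f' (t - s) * (indicator {0..B} s * ig_levy_tail \<delta> \<gamma> s))"
    proof (rule integral_dominated_convergence[where w = "\<lambda>s. C * (indicator {0..B} s * ig_levy_tail \<delta> \<gamma> s)"])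
      show "integrable lborel (\<lambda>s. C * (indicator {0..B} s * ig_levy_tail \<delta> \<gamma> s))"
        using set_integrable_ig_levy_tail(1)[OF assms(1,2), of 0 B] by (simp add: set_integrable_def)
      have "(\<lambda>n. f' (u n - s)) \<longlonglongrightarrow> f' (t - s)" for s
        using f'_cont u(2)
        by (intro isCont_tendsto_compose[where g = f'] tendsto_intros) (auto simp: continuous_on_eq_continuous_at)
      then show "AE s in lborel. (\<lambda>n. f' (u n - s) * (indicator {0..B} s * ig_levy_tail \<delta> \<gamma> s)) \<longlonglongrightarrow>
         f' (t - s) * (indicator {0..B} s * ig_levy_tail \<delta> \<gamma> s)"
        by (intro AE_I2 tendsto_mult tendsto_const)
      fix n show "AE s in lborel. norm (f' (u n - s) * (indicator {0..B} s * ig_levy_tail \<delta> \<gamma> s))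
          \<le> C * (indicator {0..B} s * ig_levy_tail \<delta> \<gamma> s)"
        unfolding norm_mult by (intro AE_I2 mult_mono) (auto simp: f'_def bound C indicator_def)
    qed measurable
    then show "(tail_convolution \<delta> \<gamma> f \<circ> u) \<longlonglongrightarrow> tail_convolution \<delta> \<gamma> f t"
      by (simp add: eq eq'[OF B] eq'[OF \<open>t \<le> B\<close>] o_def)
  qed
qed

text \<open>Divided by \<open>\<theta>\<close>, the hypothesis says that the convolution of
  \<open>v - v 0\<close> with the tail and the primitive \<open>W\<close> of \<open>w\<close> have
  the same transform, so they coincide. Adding back the convolution of the constant
  \<open>v 0\<close> and differentiating gives both conclusions.\<close>

theorem caputo_djrbashian_of_Laplace:
  assumes \<delta>: "\<delta> > 0" and \<gamma>: "\<gamma> > 0"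
    and v: "continuous_on {0..} v" "\<And>s. s \<ge> 0 \<Longrightarrow> \<bar>v s\<bar> \<le> C"
    and w: "continuous_on {0..} w" "\<And>s. s \<ge> 0 \<Longrightarrow> \<bar>w s\<bar> \<le> C"
    and Laplace: "\<And>\<theta>. \<theta> > 0 \<Longrightarrow>
      ig_exponent \<delta> \<gamma> \<theta> * (LBINT s:{0..}. exp (- \<theta> * s) * (v s - v 0)) = (LBINT s:{0..}. exp (- \<theta> * s) * w s)"
    and "t > 0"
  shows "caputo_djrbashian_differentiable \<delta> \<gamma> v t" and "caputo_djrbashian_deriv \<delta> \<gamma> v t = w t"
proof -
  define a where "a = (\<lambda>s. v s - v 0)"
  have C: "C \<ge> 0" using v(2)[of 0] by simp
  have a: "continuous_on {0..} a" "\<And>s. s \<ge> 0 \<Longrightarrow> \<bar>a s\<bar> \<le> 2 * C" "a 0 = 0"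
  proof -
    show "\<bar>a s\<bar> \<le> 2 * C" if "s \<ge> 0" for s
      using v(2)[OF that] v(2)[of 0] by (simp add: a_def)
  qed (auto simp: a_def intro!: continuous_intros v)
  have Lap_int: "set_integrable lborel {0..} (\<lambda>s. exp (- \<theta> * s) * f s)"
    if "\<theta> > 0" "continuous_on {0..} f" "\<And>s. s \<ge> 0 \<Longrightarrow> \<bar>f s\<bar> \<le> B" for \<theta> B :: real and f
    using that by (intro set_integrable_exp_bound[where a = 0 and C = B] continuous_on_atLeast_borel) auto
  define W where "W = (\<lambda>t. LBINT s:{0..t}. w s)"
  have W_int: "set_integrable lborel {0..u} w" for u
    by (intro borel_integrable_atLeastAtMost' continuous_on_subset[OF w(1)]) auto
  have W_le: "\<bar>W u\<bar> \<le> C * u" if "u \<ge> 0" for u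
  proof -
    have "\<bar>W u\<bar> \<le> (LBINT s. C * indicator {0..u} s)"
      unfolding W_def set_lebesgue_integral_def
    proof (intro order_trans[OF integral_abs_bound] integral_mono)
      show "integrable lborel (\<lambda>s. C * indicator {0..u} s)"
        by (intro integrable_mult_right integrable_real_indicator) (auto simp: emeasure_lborel_Icc_eq)
      show "integrable lborel (\<lambda>s. \<bar>indicator {0..u} s *\<^sub>R w s\<bar>)"
        using W_int[of u] by (intro integrable_abs) (simp add: set_integrable_def)
    qed (use w(2) in \<open>auto simp: indicator_def\<close>)
    then show ?thesis using that by simp
  qed
  have W_cont: "continuous_on {0..} W"
    unfolding continuous_on_eq_continuous_within
  proof
    fix u :: real assume "u \<in> {0..}"
    show "continuous (at u within {0..}) W"
    proof (cases "u = 0")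
      case True
      have "(W \<longlongrightarrow> 0) (at 0 within {0..})"
      proof (rule Lim_null_comparison)
        show "\<forall>\<^sub>F x in at 0 within {0..}. norm (W x) \<le> C * x"
          unfolding eventually_at_filter by (rule always_eventually) (auto simp: W_le)
        show "((\<lambda>x. C * x) \<longlongrightarrow> 0) (at 0 within {0..})" by (rule tendsto_eq_intros refl)+ simp
      qed
      moreover have "W 0 = 0" using W_le[of 0] by simp
      ultimately show ?thesis using True by (simp add: continuous_within)
    next
      case False
      then have "isCont W u"
        using \<open>u \<in> {0..}\<close> integral_has_derivative_interior[OF w(1), of u] unfolding W_def
        by (intro DERIV_isCont) auto
      then show ?thesis by (rule continuous_at_imp_continuous_at_within)
    qed
  qed
  have conv_eq: "tail_convolution \<delta> \<gamma> a u = W u" if "u \<ge> 0" for u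
  proof -
    \<comment> \<open>The sum of the coefficients of \<open>exp s\<close> in the bounds for the
      convolution and for \<open>W\<close>. Their common growth rate 1 is the reason why transforms
      are compared for \<open>\<theta> > 1\<close>.\<close>
    define B where "B = 2 * C * ig_exponent \<delta> \<gamma> 1 + C"
    have conv_bound: "\<bar>tail_convolution \<delta> \<gamma> a s\<bar> \<le> (2 * C * ig_exponent \<delta> \<gamma> 1) * exp (1 * s)" if "s \<ge> 0" for s
      using tail_convolution_integrable(2)[OF \<delta> \<gamma> a(1,2) that] by (simp add: mult_ac)
    have W_bound: "\<bar>W s\<bar> \<le> C * exp (1 * s)" if "s \<ge> 0" for s
    proof -
      have "s \<le> exp s" using exp_ge_add_one_self[of s] by linarith
      then have "C * s \<le> C * exp s" using C by (rule mult_left_mono)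
      then show ?thesis using W_le[OF that] by simp
    qed
    note conv_cont = continuous_on_tail_convolution[OF \<delta> \<gamma> a(1,3,2)]
    have "tail_convolution \<delta> \<gamma> a u - W u = 0"
    proof (rule Laplace_uniqueness[OF _ _ _ that, where C = B and a = 1])
      show "continuous_on {0..} (\<lambda>t. tail_convolution \<delta> \<gamma> a t - W t)"
        by (intro continuous_intros conv_cont W_cont)
      show "\<bar>tail_convolution \<delta> \<gamma> a s - W s\<bar> \<le> B * exp (1 * s)" if "s \<ge> 0" for s
        using conv_bound[OF that] W_bound[OF that] by (simp add: B_def algebra_simps)
      fix \<theta> :: real assume "1 < \<theta>"
      then have \<theta>: "\<theta> > 0" by simp
      have "(LBINT t:{0..}. exp (- \<theta> * t) * (tail_convolution \<delta> \<gamma> a t - W t)) =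
          (LBINT t:{0..}. exp (- \<theta> * t) * tail_convolution \<delta> \<gamma> a t) - (LBINT t:{0..}. exp (- \<theta> * t) * W t)"
        unfolding right_diff_distrib
        using set_integrable_exp_bound[OF continuous_on_atLeast_borel[OF conv_cont] conv_bound \<open>1 < \<theta>\<close>]
          set_integrable_exp_bound[OF continuous_on_atLeast_borel[OF W_cont] W_bound \<open>1 < \<theta>\<close>]
        by (rule set_integral_diff(2))
      also have "(LBINT t:{0..}. exp (- \<theta> * t) * tail_convolution \<delta> \<gamma> a t) =
          (LBINT s:{0..}. exp (- \<theta> * s) * a s) * (ig_exponent \<delta> \<gamma> \<theta> / \<theta>)"
        unfolding tail_convolution_def Laplace_ig_levy_tail(2)[OF \<delta> \<gamma> \<theta>, symmetric]
        by (rule Laplace_convolution[OF Lap_int[OF \<theta> a(1,2)] Laplace_ig_levy_tail(1)[OF \<delta> \<gamma> \<theta>]])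
      \<comment> \<open>\<open>W\<close> is the convolution of \<open>w\<close> with the constant 1,
        whose transform is \<open>1 / \<theta>\<close>.\<close>
      also have "(LBINT t:{0..}. exp (- \<theta> * t) * W t) = (LBINT s:{0..}. exp (- \<theta> * s) * w s) * (1 / \<theta>)"
        using Laplace_convolution[OF Lap_int[OF \<theta> w], of "\<lambda>_. 1"] set_integrable_exp_neg[OF \<theta>]
        by (simp add: W_def)
      also have "(LBINT s:{0..}. exp (- \<theta> * s) * w s) = ig_exponent \<delta> \<gamma> \<theta> * (LBINT s:{0..}. exp (- \<theta> * s) * a s)"
        using Laplace[OF \<theta>] by (simp add: a_def)
      finally show "(LBINT t:{0..}. exp (- \<theta> * t) * (tail_convolution \<delta> \<gamma> a t - W t)) = 0" by simp
    qed
    then show ?thesis by simp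
  qed
  \<comment> \<open>Cutting at \<open>t / 2\<close> puts the singularity of the tail into a
    constant; what depends on \<open>u\<close> near \<open>t\<close> is a primitive of a continuous
    function. The resulting formula holds on \<open>{t / 2<..}\<close>, an open set around
    \<open>t\<close>.\<close>
  define T where "T = (LBINT s:{0..t / 2}. ig_levy_tail \<delta> \<gamma> s)"
  have tail_cont: "continuous_on {t / 2..} (ig_levy_tail \<delta> \<gamma>)"
    using \<open>t > 0\<close> isCont_ig_levy_tail[OF \<delta> \<gamma>] by (intro continuous_at_imp_continuous_on) auto
  have conv_v: "tail_convolution \<delta> \<gamma> v u = W u + v 0 * (T + (LBINT s:{t / 2..u}. ig_levy_tail \<delta> \<gamma> s))"
    if "u > t / 2" for u
  proof -
    have "tail_convolution \<delta> \<gamma> v u = (LBINT s:{0..u}. a s * ig_levy_tail \<delta> \<gamma> (u - s) + v 0 * ig_levy_tail \<delta> \<gamma> (u - s))"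
      unfolding tail_convolution_def by (simp add: a_def algebra_simps)
    also have "\<dots> = tail_convolution \<delta> \<gamma> a u + tail_convolution \<delta> \<gamma> (\<lambda>_. v 0) u"
      unfolding tail_convolution_def
      by (intro set_integral_add(2) tail_convolution_integrable(1)[OF \<delta> \<gamma>, where C = "2 * C"] a
          tail_convolution_integrable(1)[OF \<delta> \<gamma>, where C = "\<bar>v 0\<bar>"]) auto
    also have "tail_convolution \<delta> \<gamma> (\<lambda>_. v 0) u = v 0 * (LBINT s:{0..u}. ig_levy_tail \<delta> \<gamma> s)"
      using tail_convolution_integrable(3)[OF \<delta> \<gamma>, of "\<lambda>_. v 0" "\<bar>v 0\<bar>" u] by simp
    also have "(LBINT s:{0..u}. ig_levy_tail \<delta> \<gamma> s) = T + (LBINT s:{t / 2..u}. ig_levy_tail \<delta> \<gamma> s)"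
    proof -
      have "{0..u} = {0..t / 2} \<union> {t / 2..u}" using that \<open>t > 0\<close> by auto
      moreover have "(LBINT s:{0..t / 2} \<union> {t / 2..u}. ig_levy_tail \<delta> \<gamma> s) = T + (LBINT s:{t / 2..u}. ig_levy_tail \<delta> \<gamma> s)"
        unfolding T_def
      proof (rule set_integral_Un_AE)
        show "AE s in lborel. \<not> (s \<in> {0..t / 2} \<and> s \<in> {t / 2..u})"
          using AE_lborel_singleton[of "t / 2"] by eventually_elim auto
      qed (use set_integrable_ig_levy_tail(1)[OF \<delta> \<gamma>] \<open>t > 0\<close> in auto)
      ultimately show ?thesis by simp
    qed
    finally show ?thesis using conv_eq[of u] that \<open>t > 0\<close> by simp
  qed
  have "((\<lambda>u. W u + v 0 * (T + (LBINT s:{t / 2..u}. ig_levy_tail \<delta> \<gamma> s))) has_field_derivative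
      w t + v 0 * (0 + ig_levy_tail \<delta> \<gamma> t)) (at t)"
    unfolding W_def using \<open>t > 0\<close>
    by (intro DERIV_add DERIV_cmult DERIV_const integral_has_derivative_interior w(1) tail_cont) auto
  then have deriv: "(tail_convolution \<delta> \<gamma> v has_field_derivative w t + v 0 * ig_levy_tail \<delta> \<gamma> t) (at t)"
    by (rule has_field_derivative_transform_within_open[where S = "{t / 2<..}", THEN DERIV_cong])
      (use \<open>t > 0\<close> conv_v in auto)
  then show "caputo_djrbashian_deriv \<delta> \<gamma> v t = w t"
    by (simp add: caputo_djrbashian_deriv_def DERIV_imp_deriv)
  show "caputo_djrbashian_differentiable \<delta> \<gamma> v t"
    unfolding caputo_djrbashian_differentiable_def
    using deriv tail_convolution_integrable(1)[OF \<delta> \<gamma> v] by (auto simp: field_differentiable_def)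
qed

section \<open>First passage of the subordinator\<close>

text \<open>What the pathwise inversion needs: unboundedness keeps the set under the infimum
  nonempty, right-continuity gives strict inequalities for first passage, and strict monotonicity
  makes the inverse continuous.\<close>

definition regular_path :: "(real \<Rightarrow> real) \<Rightarrow> bool" where
  "regular_path d \<longleftrightarrow> d 0 = 0 \<and> strict_mono_on {0..} d \<and> (\<forall>t\<ge>0. (d \<longlongrightarrow> d t) (at_right t)) \<and>
     (\<forall>t. \<exists>r\<ge>0. d r > t)"

section \<open>Inversion of a single path\<close>

context
  fixes D :: "real \<Rightarrow> 'a \<Rightarrow> real" and \<omega> :: 'a
  assumes path: "regular_path (\<lambda>t. D t \<omega>)"
begin

lemma regular_path_less: "0 \<le> r \<Longrightarrow> r < s \<Longrightarrow> D r \<omega> < D s \<omega>"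
  using path by (auto simp: regular_path_def intro: strict_mono_onD[of "{0..}" "\<lambda>t. D t \<omega>"])

lemma inverse_process_nonempty: "{r. 0 \<le> r \<and> D r \<omega> > t} \<noteq> {}"
  using path by (auto simp: regular_path_def)

lemma inverse_process_bdd_below: "bdd_below {r. 0 \<le> r \<and> D r \<omega> > t}"
  by (rule bdd_belowI[of _ 0]) auto

lemma inverse_process_nonneg: "0 \<le> inverse_process D t \<omega>"
  unfolding inverse_process_def by (rule cInf_greatest[OF inverse_process_nonempty]) auto

lemma inverse_process_le: "0 \<le> r \<Longrightarrow> t < D r \<omega> \<Longrightarrow> inverse_process D t \<omega> \<le> r"
  unfolding inverse_process_def by (rule cInf_lower[OF _ inverse_process_bdd_below]) auto

lemma less_inverse_process_imp: "0 \<le> u \<Longrightarrow> u < inverse_process D s \<omega> \<Longrightarrow> D u \<omega> \<le> s"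
  using inverse_process_le[of u s] by force

text \<open>Right-continuity keeps \<open>D\<close> below \<open>s\<close> on an interval beyond
  \<open>u\<close>, so the infimum is strictly larger than \<open>u\<close>. Together with
  \<open>less_inverse_process_imp\<close> this decides
  \<open>u < inverse_process D s \<omega>\<close> except at the single time
  \<open>s = D u \<omega>\<close>.\<close>

lemma less_inverse_processI:
  assumes "0 \<le> u" "D u \<omega> < s" shows "u < inverse_process D s \<omega>"
proof -
  have "((\<lambda>t. D t \<omega>) \<longlongrightarrow> D u \<omega>) (at_right u)" using path assms by (simp add: regular_path_def)
  then have "\<forall>\<^sub>F x in at_right u. D x \<omega> < s" using assms(2) by (rule order_tendstoD)
  then obtain b where b: "b > u" "\<And>x. u < x \<Longrightarrow> x < b \<Longrightarrow> D x \<omega> < s"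
    by (auto simp: eventually_at_right_field)
  have "D r \<omega> < s" if "0 \<le> r" "r \<le> u" for r
    using regular_path_less[of r u] that assms by (cases "r = u") auto
  then have "b \<le> r" if "r \<in> {r. 0 \<le> r \<and> D r \<omega> > s}" for r
    using that b(2)[of r] by (cases "r \<le> u") force+
  then have "b \<le> inverse_process D s \<omega>"
    unfolding inverse_process_def by (intro cInf_greatest inverse_process_nonempty)
  with b(1) show ?thesis by simp
qed

lemma inverse_process_0: "inverse_process D 0 \<omega> = 0"
proof (rule antisym)
  show "inverse_process D 0 \<omega> \<le> 0"
  proof (rule field_le_epsilon)
    fix r :: real assume "r > 0"
    then have "D 0 \<omega> < D r \<omega>" "D 0 \<omega> = 0" using path regular_path_less[of 0 r] by (auto simp: regular_path_def)
    then show "inverse_process D 0 \<omega> \<le> 0 + r" using \<open>r > 0\<close> by (simp add: inverse_process_le)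
  qed
qed (rule inverse_process_nonneg)

text \<open>A jump of the inverse would be a flat stretch of \<open>D\<close>. In the lower bound, a
  point \<open>r\<close> strictly between \<open>a\<close> and the inverse turns
  \<open>D r \<omega> \<le> t\<close> into \<open>D a \<omega> < t\<close>, which persists near
  \<open>t\<close>; the upper bound comes from the infimum alone.\<close>

lemma isCont_inverse_process: "isCont (\<lambda>t. inverse_process D t \<omega>) t"
  unfolding continuous_at
proof (rule order_tendstoI)
  fix a assume a: "a < inverse_process D t \<omega>"
  show "\<forall>\<^sub>F s in at t. a < inverse_process D s \<omega>"
  proof (cases "a < 0")
    case True
    then show ?thesis using inverse_process_nonneg less_le_trans by (intro always_eventually) blast
  next
    case False
    obtain r where r: "a < r" "r < inverse_process D t \<omega>" using a dense by blast
    then have "D a \<omega> < D r \<omega>" using False by (intro regular_path_less) auto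
    also have "D r \<omega> \<le> t" using r False by (intro less_inverse_process_imp) auto
    finally have "\<forall>\<^sub>F s in at t. D a \<omega> < s" by (intro order_tendstoD(1)[OF tendsto_ident_at])
    then show ?thesis by eventually_elim (use False less_inverse_processI in auto)
  qed
next
  fix b assume "inverse_process D t \<omega> < b"
  then obtain r where r: "0 \<le> r" "t < D r \<omega>" "r < b"
    using cInf_lessD[OF inverse_process_nonempty[of t]] unfolding inverse_process_def by blast
  have "\<forall>\<^sub>F s in at t. s < D r \<omega>" using r(2) by (intro order_tendstoD(2)[OF tendsto_ident_at])
  then show "\<forall>\<^sub>F s in at t. inverse_process D s \<omega> < b"
    by eventually_elim (use r inverse_process_le in force)
qed

end

text \<open>Measurability of the inverse is an assumption since the path properties hold only almost
  surely and \<open>M\<close> is not assumed to be complete.\<close>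

locale ig_first_passage = prob_space M for M :: "'a measure" +
  fixes \<delta> \<gamma> :: real and D :: "real \<Rightarrow> 'a \<Rightarrow> real"
  assumes \<delta>: "\<delta> > 0" and \<gamma>: "\<gamma> > 0"
    and subordinator: "inverse_gaussian_subordinator M \<delta> \<gamma> D"
    and inverse_measurable: "\<And>t. t \<ge> 0 \<Longrightarrow> inverse_process D t \<in> borel_measurable M"
begin

section \<open>Almost sure regularity of the paths\<close>

lemma levy: "levy_process M D" and AE_mono: "AE \<omega> in M. mono_on {0..} (\<lambda>t. D t \<omega>)"
  using subordinator by (auto simp: inverse_gaussian_subordinator_def levy_subordinator_def)

lemma D_measurable: "t \<ge> 0 \<Longrightarrow> D t \<in> borel_measurable M"
  using levy by (simp add: levy_process_def)

lemma Laplace_D: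
  assumes "t \<ge> 0" "s \<ge> 0"
  shows "expectation (\<lambda>\<omega>. exp (- s * D t \<omega>)) = exp (- t * ig_exponent \<delta> \<gamma> s)"
  using subordinator assms
  by (simp add: inverse_gaussian_subordinator_def ig_exponent_def mult.assoc)

text \<open>The integral of a non-integrable function is 0 by convention, whereas the Laplace
  transform is positive.\<close>

lemma integrable_exp_D:
  assumes "t \<ge> 0" "s \<ge> 0"
  shows "integrable M (\<lambda>\<omega>. exp (- s * D t \<omega>))"
  using Laplace_D[OF assms] not_integrable_integral_eq by fastforce

text \<open>A Chernoff bound. With \<open>m = 0\<close> and \<open>s\<close> tending to infinity it
  excludes the value 0; with \<open>s = 1\<close> and \<open>t\<close> tending to infinity it
  excludes bounded paths.\<close>

lemma prob_le_exp_D: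
  assumes "t \<ge> 0" "s \<ge> 0" "{\<omega> \<in> space M. P \<omega>} \<in> events" "\<And>\<omega>. P \<omega> \<Longrightarrow> D t \<omega> \<le> m"
  shows "\<P>(\<omega> in M. P \<omega>) \<le> exp (s * m - t * ig_exponent \<delta> \<gamma> s)"
proof -
  have "\<P>(\<omega> in M. P \<omega>) = expectation (indicator {\<omega> \<in> space M. P \<omega>})" using assms(3) by simp
  also have "\<dots> \<le> expectation (\<lambda>\<omega>. exp (s * m) * exp (- s * D t \<omega>))"
  proof (rule integral_mono)
    fix \<omega>
    have "s * D t \<omega> \<le> s * m" if "P \<omega>" using assms that by (intro mult_left_mono) auto
    then show "indicator {\<omega> \<in> space M. P \<omega>} \<omega> \<le> exp (s * m) * exp (- s * D t \<omega>)"
      by (auto simp: indicator_def exp_add[symmetric])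
    show "integrable M (indicator {\<omega> \<in> space M. P \<omega>} :: 'a \<Rightarrow> real)"
      using assms(3) by (intro integrable_real_indicator) (auto simp: emeasure_eq_measure)
    show "integrable M (\<lambda>\<omega>. exp (s * m) * exp (- s * D t \<omega>))"
      using integrable_exp_D[OF assms(1,2)] by (rule integrable_mult_right)
  qed
  also have "\<dots> = exp (s * m - t * ig_exponent \<delta> \<gamma> s)"
    using Laplace_D[OF assms(1,2)] by (simp add: exp_diff exp_minus divide_inverse)
  finally show ?thesis .
qed

lemma AE_D_neq_0:
  assumes "h > 0" shows "AE \<omega> in M. D h \<omega> \<noteq> 0"
proof -
  have [measurable]: "D h \<in> borel_measurable M" using assms by (intro D_measurable) simp
  have "((\<lambda>s. exp (- h * (\<delta> * (sqrt (2 * s + \<gamma>\<^sup>2) - \<gamma>)))) \<longlongrightarrow> 0) at_top"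
    using \<delta> \<gamma> assms by real_asymp
  moreover have "\<forall>\<^sub>F s in at_top. \<P>(\<omega> in M. D h \<omega> = 0) \<le> exp (- h * (\<delta> * (sqrt (2 * s + \<gamma>\<^sup>2) - \<gamma>)))"
    using eventually_ge_at_top[of 0]
  proof eventually_elim
    fix s :: real assume "s \<ge> 0"
    then show "\<P>(\<omega> in M. D h \<omega> = 0) \<le> exp (- h * (\<delta> * (sqrt (2 * s + \<gamma>\<^sup>2) - \<gamma>)))"
      using prob_le_exp_D[of h s "\<lambda>\<omega>. D h \<omega> = 0" 0] assms by (simp add: ig_exponent_def)
  qed
  ultimately have "\<P>(\<omega> in M. D h \<omega> = 0) \<le> 0" by (rule tendsto_lowerbound) simp
  then have "\<P>(\<omega> in M. D h \<omega> = 0) = 0" by (simp add: measure_le_0_iff)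
  then show ?thesis by (subst (asm) prob_eq_0) auto
qed

text \<open>By stationarity the increment has the law of \<open>D (r - q)\<close>, which does not
  charge 0; monotonicity determines its sign.\<close>

lemma AE_D_less:
  assumes "0 \<le> q" "q < r" shows "AE \<omega> in M. D q \<omega> < D r \<omega>"
proof -
  have [measurable]: "D q \<in> borel_measurable M" "D r \<in> borel_measurable M" "D (r - q) \<in> borel_measurable M"
    using assms by (auto intro: D_measurable)
  have "\<forall>s\<ge>0. \<forall>h\<ge>0. distr M borel (\<lambda>\<omega>. D (s + h) \<omega> - D s \<omega>) = distr M borel (D h)"
    using levy by (simp add: levy_process_def)
  from this[rule_format, of q "r - q"] assms
  have distr: "distr M borel (\<lambda>\<omega>. D r \<omega> - D q \<omega>) = distr M borel (D (r - q))" by simp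
  have "AE x in distr M borel (D (r - q)). x \<noteq> 0"
    using AE_D_neq_0[of "r - q"] assms by (subst AE_distr_iff) auto
  then have "AE \<omega> in M. D r \<omega> - D q \<omega> \<noteq> 0"
    unfolding distr[symmetric] by (subst (asm) AE_distr_iff) auto
  with AE_mono show ?thesis
  proof eventually_elim
    fix \<omega> assume "mono_on {0..} (\<lambda>t. D t \<omega>)" "D r \<omega> - D q \<omega> \<noteq> 0"
    then show "D q \<omega> < D r \<omega>" using assms by (auto dest!: mono_onD[of _ _ q r])
  qed
qed

lemma AE_D_unbounded: "AE \<omega> in M. \<exists>r::nat. D (real r) \<omega> > real m"
proof -
  have [measurable]: "D (real r) \<in> borel_measurable M" for r by (rule D_measurable) simp
  have "(\<lambda>r. exp (1 * real m - real r * ig_exponent \<delta> \<gamma> 1)) \<longlonglongrightarrow> 0"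
    using ig_exponent_pos[OF \<delta>, of 1 \<gamma>] by real_asymp
  then have "\<P>(\<omega> in M. \<forall>r::nat. D (real r) \<omega> \<le> real m) \<le> 0"
  proof (rule tendsto_lowerbound)
    show "\<forall>\<^sub>F r in sequentially. \<P>(\<omega> in M. \<forall>r::nat. D (real r) \<omega> \<le> real m) \<le> exp (1 * real m - real r * ig_exponent \<delta> \<gamma> 1)"
    proof (intro always_eventually allI)
      fix r :: nat
      show "\<P>(\<omega> in M. \<forall>r::nat. D (real r) \<omega> \<le> real m) \<le> exp (1 * real m - real r * ig_exponent \<delta> \<gamma> 1)"
        by (rule prob_le_exp_D) auto
    qed
  qed simp
  then have "\<P>(\<omega> in M. \<forall>r::nat. D (real r) \<omega> \<le> real m) = 0" by (simp add: measure_le_0_iff)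
  then have "AE \<omega> in M. \<not> (\<forall>r::nat. D (real r) \<omega> \<le> real m)" by (subst (asm) prob_eq_0) auto
  then show ?thesis by eventually_elim (simp add: not_le)
qed

text \<open>Strict increase involves uncountably many pairs of times. It is secured for rational
  pairs, of which there are countably many, and carried over by monotonicity with two rationals
  inserted between \<open>s\<close> and \<open>t\<close>.\<close>

lemma AE_regular_path: "AE \<omega> in M. regular_path (\<lambda>t. D t \<omega>)"
proof -
  have "AE \<omega> in M. \<forall>q\<in>\<rat>. \<forall>r\<in>\<rat>. 0 \<le> q \<longrightarrow> q < r \<longrightarrow> D q \<omega> < D r \<omega>"
  proof -
    have "AE \<omega> in M. 0 \<le> q \<longrightarrow> q < r \<longrightarrow> D q \<omega> < D r \<omega>" for q r
      using AE_D_less[of q r] by (cases "0 \<le> q \<and> q < r") (auto elim: eventually_mono)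
    then show ?thesis by (simp add: AE_ball_countable countable_rat)
  qed
  moreover have "AE \<omega> in M. \<forall>m::nat. \<exists>r::nat. D (real r) \<omega> > real m"
    by (simp add: AE_all_countable AE_D_unbounded)
  moreover have "AE \<omega> in M. D 0 \<omega> = 0" "AE \<omega> in M. \<forall>t\<ge>0. ((\<lambda>u. D u \<omega>) \<longlongrightarrow> D t \<omega>) (at_right t)"
    using levy by (auto simp: levy_process_def elim: eventually_mono)
  ultimately show ?thesis using AE_mono
  proof eventually_elim
    case (elim \<omega>)
    have "strict_mono_on {0..} (\<lambda>t. D t \<omega>)"
    proof (rule strict_mono_onI)
      fix s t :: real assume st: "s \<in> {0..}" "t \<in> {0..}" "s < t"
      then obtain q where q: "q \<in> \<rat>" "s < q" "q < t" using Rats_dense_in_real by blast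
      obtain r where r: "r \<in> \<rat>" "q < r" "r < t" using q Rats_dense_in_real by blast
      have "D s \<omega> \<le> D q \<omega>" "D r \<omega> \<le> D t \<omega>"
        using elim(5) st q r by (auto intro!: mono_onD[of "{0..}" "\<lambda>t. D t \<omega>"])
      moreover have "D q \<omega> < D r \<omega>" using elim(1) q r st by auto
      ultimately show "D s \<omega> < D t \<omega>" by simp
    qed
    moreover have "\<exists>r\<ge>0. D r \<omega> > t" for t
    proof -
      obtain m :: nat where "t \<le> real m" using real_arch_simple by blast
      moreover obtain r :: nat where "D (real r) \<omega> > real m" using elim(2) by blast
      ultimately have "D (real r) \<omega> > t" by simp
      then show ?thesis by (intro exI[of _ "real r"]) auto
    qed
    ultimately show ?case using elim by (auto simp: regular_path_def)
  qed
qed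

end

section \<open>First passage at an exponential time\<close>

text \<open>Rounding \<open>s\<close> down to multiples of \<open>1 / real (Suc n)\<close> leaves
  countably many values, hence joint measurability; continuity in \<open>s\<close> carries it to the
  limit.\<close>

lemma measurable_Caratheodory:
  fixes f :: "real \<Rightarrow> 'a \<Rightarrow> real"
  assumes meas: "\<And>s. f s \<in> borel_measurable M"
    and cont: "\<And>\<omega> s. \<omega> \<in> space M \<Longrightarrow> isCont (\<lambda>s. f s \<omega>) s"
  shows "(\<lambda>(s, \<omega>). f s \<omega>) \<in> borel_measurable (borel \<Otimes>\<^sub>M M)"
proof -
  define a where "a = (\<lambda>(n::nat) (s::real). of_int \<lfloor>real (Suc n) * s\<rfloor> / real (Suc n))"
  have a_lim: "(\<lambda>n. a n s) \<longlonglongrightarrow> s" for s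
  proof (rule tendsto_sandwich[of "\<lambda>n. s - 1 / real (Suc n)" _ _ "\<lambda>n. s"])
    have "s - 1 / real (Suc n) \<le> a n s \<and> a n s \<le> s" for n
    proof -
      have "(real (Suc n) * s - 1) / real (Suc n) \<le> a n s" "a n s \<le> (real (Suc n) * s) / real (Suc n)"
        unfolding a_def by (rule divide_right_mono; linarith)+
      moreover have "(real (Suc n) * s - 1) / real (Suc n) = s - 1 / real (Suc n)"
        by (simp add: diff_divide_distrib del: of_nat_Suc)
      ultimately show ?thesis by (simp del: of_nat_Suc)
    qed
    then show "\<forall>\<^sub>F n in sequentially. s - 1 / real (Suc n) \<le> a n s" "\<forall>\<^sub>F n in sequentially. a n s \<le> s"
      by auto
    show "(\<lambda>n. s - 1 / real (Suc n)) \<longlonglongrightarrow> s" by real_asymp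
  qed simp
  show ?thesis
  proof (rule borel_measurable_LIMSEQ_real)
    fix x :: "real \<times> 'a" assume "x \<in> space (borel \<Otimes>\<^sub>M M)"
    then have "snd x \<in> space M" by (auto simp: space_pair_measure)
    then show "(\<lambda>n. f (a n (fst x)) (snd x)) \<longlonglongrightarrow> (case x of (s, \<omega>) \<Rightarrow> f s \<omega>)"
      using isCont_tendsto_compose[OF cont a_lim] by (simp add: case_prod_beta)
  next
    fix n
    have "(\<lambda>x. f (of_int \<lfloor>real (Suc n) * fst x\<rfloor> / real (Suc n)) (snd x)) \<in> borel_measurable (borel \<Otimes>\<^sub>M M)"
      by (rule measurable_compose_countable[where f = "\<lambda>i x. f (of_int i / real (Suc n)) (snd x)" and g = "\<lambda>x. \<lfloor>real (Suc n) * fst x\<rfloor>"])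
        (use meas in measurable)
    then show "(\<lambda>x. f (a n (fst x)) (snd x)) \<in> borel_measurable (borel \<Otimes>\<^sub>M M)"
      by (simp add: a_def)
  qed
qed

lemma integral_exponential_density:
  "(LBINT s. exponential_density \<theta> s * f s) = \<theta> * (LBINT s:{0..}. exp (- \<theta> * s) * f s)"
  unfolding set_lebesgue_integral_def integral_mult_right_zero[symmetric]
  by (intro Bochner_Integration.integral_cong) (auto simp: exponential_density_def indicator_def mult_ac)

context ig_first_passage
begin

text \<open>Both sides are the mean of \<open>w\<close> at the first-passage time of an independent
  exponential level, taken on a product space: one side by Fubini, the other from the exponential
  law that the survival function identifies.\<close>

lemma exponential_time:
  fixes w :: "real \<Rightarrow> real"
  assumes w: "continuous_on UNIV w" "\<And>u. \<bar>w u\<bar> \<le> C" and \<theta>: "\<theta> > 0"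
  shows "\<theta> * (LBINT s:{0..}. exp (- \<theta> * s) * expectation (\<lambda>\<omega>. w (inverse_process D s \<omega>)))
     = ig_exponent \<delta> \<gamma> \<theta> * (LBINT u:{0..}. exp (- ig_exponent \<delta> \<gamma> \<theta> * u) * w u)"
proof -
  define \<phi> where "\<phi> = ig_exponent \<delta> \<gamma> \<theta>"
  have \<phi>: "\<phi> > 0" using ig_exponent_pos[OF \<delta> \<theta>] by (simp add: \<phi>_def)
  have [measurable]: "w \<in> borel_measurable borel" using w(1) by (rule borel_measurable_continuous_onI)
  \<comment> \<open>The irregular paths need not form an event, so a measurable null set covering
    them is removed.\<close>
  obtain Z where Z: "Z \<in> null_sets M" "{\<omega> \<in> space M. \<not> regular_path (\<lambda>t. D t \<omega>)} \<subseteq> Z"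
    using AE_regular_path by (auto elim!: AE_E)
  define G where "G = space M - Z"
  have G[measurable]: "G \<in> events" using Z(1) by (auto simp: G_def)
  have AE_G: "AE \<omega> in M. \<omega> \<in> G" using AE_not_in[OF Z(1)] AE_space by eventually_elim (simp add: G_def)
  have G_path: "regular_path (\<lambda>t. D t \<omega>)" if "\<omega> \<in> G" for \<omega> using that Z(2) by (auto simp: G_def)
  \<comment> \<open>a version of the first-passage time with continuous paths everywhere, hence jointly measurable\<close>
  define e where "e = (\<lambda>s \<omega>. if \<omega> \<in> G then inverse_process D (max s 0) \<omega> else 0)"
  have e_meas[measurable]: "e s \<in> borel_measurable M" for s
    unfolding e_def using inverse_measurable[of "max s 0"] by measurable
  have joint[measurable]: "(\<lambda>(s, \<omega>). e s \<omega>) \<in> borel_measurable (borel \<Otimes>\<^sub>M M)"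
  proof (rule measurable_Caratheodory[OF e_meas])
    fix \<omega> s
    have "isCont (\<lambda>s. inverse_process D (max s 0) \<omega>) s" if "\<omega> \<in> G"
      by (rule isCont_o2[OF _ isCont_inverse_process[where D = D and \<omega> = \<omega>, OF G_path[OF that]]]) (intro continuous_intros)
    then show "isCont (\<lambda>s. e s \<omega>) s" by (cases "\<omega> \<in> G") (simp_all add: e_def)
  qed
  define T where "T = density lborel (\<lambda>s. ennreal (exponential_density \<theta> s))"
  interpret T: prob_space T unfolding T_def using \<theta> by (rule prob_space_exponential_density)
  interpret Q: pair_prob_space T M ..
  have sets_T[measurable_cong]: "sets T = sets borel" by (simp add: T_def)
  have "distributed (T \<Otimes>\<^sub>M M) lborel (\<lambda>(s, \<omega>). e s \<omega>) (exponential_density \<phi>)"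
    unfolding Q.exponential_distributed_iff[OF \<phi>]
  proof safe
    show meas: "(\<lambda>(s, \<omega>). e s \<omega>) \<in> borel_measurable (T \<Otimes>\<^sub>M M)" by measurable
    fix u :: real assume u: "u \<ge> 0"
    have Du: "D u \<in> borel_measurable M" using u by (rule D_measurable)
    define A where "A = {x \<in> space (T \<Otimes>\<^sub>M M). u < (case x of (s, \<omega>) \<Rightarrow> e s \<omega>)}"
    have A: "A \<in> sets (T \<Otimes>\<^sub>M M)" unfolding A_def using meas by measurable
    \<comment> \<open>Sections at fixed \<open>\<omega>\<close>: an exponential level exceeds
      \<open>D u \<omega>\<close> with probability \<open>exp (- \<theta> * D u \<omega>)\<close>,
      whose mean is the Laplace transform of \<open>D u\<close>.\<close>
    have "emeasure (T \<Otimes>\<^sub>M M) A = (\<integral>\<^sup>+\<omega>. emeasure T ((\<lambda>s. (s, \<omega>)) -` A) \<partial>M)"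
      using A by (rule Q.emeasure_pair_measure_alt2)
    also have "\<dots> = (\<integral>\<^sup>+\<omega>. ennreal (exp (- \<theta> * D u \<omega>)) \<partial>M)"
    proof (rule nn_integral_cong_AE, use AE_G AE_space in eventually_elim)
      fix \<omega> assume \<omega>: "\<omega> \<in> G" "\<omega> \<in> space M"
      note path = G_path[OF \<omega>(1)]
      have D0: "D u \<omega> \<ge> 0"
        using path regular_path_less[where D = D and \<omega> = \<omega>, OF path, of 0 u] u by (cases "u = 0") (auto simp: regular_path_def)
      have sec: "(\<lambda>s. (s, \<omega>)) -` A = {s. u < e s \<omega>}"
        using \<omega> by (auto simp: A_def space_pair_measure T_def)
      have [measurable]: "(\<lambda>s. e s \<omega>) \<in> borel_measurable borel"
        using measurable_compose[OF measurable_Pair2'[OF \<omega>(2), of borel] joint] by simp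
      have "emeasure T {s. u < e s \<omega>} = (\<integral>\<^sup>+s. ennreal (exponential_density \<theta> s) * indicator {s. u < e s \<omega>} s \<partial>lborel)"
        unfolding T_def by (rule emeasure_density) auto
      also have "\<dots> = (\<integral>\<^sup>+s. ennreal \<theta> * (ennreal (exp (- \<theta> * s)) * indicator {D u \<omega>..} s) \<partial>lborel)"
      proof (rule nn_integral_cong_AE, use AE_lborel_singleton[of "D u \<omega>"] in eventually_elim)
        fix s assume "s \<noteq> D u \<omega>"
        then show "ennreal (exponential_density \<theta> s) * indicator {s. u < e s \<omega>} s =
            ennreal \<theta> * (ennreal (exp (- \<theta> * s)) * indicator {D u \<omega>..} s)"
          using less_inverse_processI[where D = D and \<omega> = \<omega>, OF path u, of s] less_inverse_process_imp[where D = D and \<omega> = \<omega>, OF path u, of s] D0 \<theta> \<omega>(1)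
          by (auto simp: exponential_density_def indicator_def e_def ennreal_mult mult_ac)
      qed
      also have "\<dots> = ennreal \<theta> * ennreal (exp (- \<theta> * D u \<omega>) / \<theta>)"
        unfolding nn_integral_exp_neg[OF \<theta>, symmetric] by (rule nn_integral_cmult) auto
      also have "\<dots> = ennreal (exp (- \<theta> * D u \<omega>))" using \<theta> by (simp add: ennreal_mult[symmetric])
      finally show "emeasure T ((\<lambda>s. (s, \<omega>)) -` A) = ennreal (exp (- \<theta> * D u \<omega>))" by (simp only: sec)
    qed
    also have "\<dots> = ennreal (exp (- u * \<phi>))"
      using integrable_exp_D[OF u, of \<theta>] Laplace_D[OF u, of \<theta>] \<theta>
      by (subst nn_integral_eq_integral) (auto simp: \<phi>_def)
    finally have "measure (T \<Otimes>\<^sub>M M) A = exp (- u * \<phi>)" by (simp add: measure_def)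
    moreover have "{x \<in> space (T \<Otimes>\<^sub>M M). (case x of (s, \<omega>) \<Rightarrow> e s \<omega>) \<le> u} = space (T \<Otimes>\<^sub>M M) - A"
      by (auto simp: A_def)
    ultimately show "\<P>(x in T \<Otimes>\<^sub>M M. (case x of (s, \<omega>) \<Rightarrow> e s \<omega>) \<le> u) = 1 - exp (- u * \<phi>)"
      using Q.prob_compl[OF A] by simp
  qed
  then have "(LBINT u. exponential_density \<phi> u * w u) = (\<integral>x. w (case x of (s, \<omega>) \<Rightarrow> e s \<omega>) \<partial>(T \<Otimes>\<^sub>M M))"
    using \<phi> by (intro distributed_integral) auto
  also have "\<dots> = (\<integral>s. expectation (\<lambda>\<omega>. w (e s \<omega>)) \<partial>T)"
  proof -
    have "integrable (T \<Otimes>\<^sub>M M) (\<lambda>x. w (case x of (s, \<omega>) \<Rightarrow> e s \<omega>))"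
      by (rule Q.integrable_const_bound[where B = C]) (use w(2) in auto)
    from Q.integral_fst'[OF this] show ?thesis by simp
  qed
  also have "\<dots> = (LBINT s. exponential_density \<theta> s * expectation (\<lambda>\<omega>. w (e s \<omega>)))"
    unfolding T_def using \<theta> by (subst integral_density) (auto intro!: AE_I2)
  also have "\<dots> = \<theta> * (LBINT s:{0..}. exp (- \<theta> * s) * expectation (\<lambda>\<omega>. w (e s \<omega>)))"
    by (rule integral_exponential_density)
  also have "(LBINT s:{0..}. exp (- \<theta> * s) * expectation (\<lambda>\<omega>. w (e s \<omega>))) =
      (LBINT s:{0..}. exp (- \<theta> * s) * expectation (\<lambda>\<omega>. w (inverse_process D s \<omega>)))"
  proof (rule set_lebesgue_integral_cong)
    show "\<forall>s. s \<in> {0..} \<longrightarrow> exp (- \<theta> * s) * expectation (\<lambda>\<omega>. w (e s \<omega>)) =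
        exp (- \<theta> * s) * expectation (\<lambda>\<omega>. w (inverse_process D s \<omega>))"
    proof safe
      fix s :: real assume "0 \<le> s"
      have [measurable]: "inverse_process D s \<in> borel_measurable M" using \<open>0 \<le> s\<close> by (rule inverse_measurable)
      have "expectation (\<lambda>\<omega>. w (e s \<omega>)) = expectation (\<lambda>\<omega>. w (inverse_process D s \<omega>))"
      proof (rule integral_cong_AE)
        show "AE \<omega> in M. w (e s \<omega>) = w (inverse_process D s \<omega>)"
          using AE_G by eventually_elim (use \<open>0 \<le> s\<close> in \<open>simp add: e_def\<close>)
      qed measurable
      then show "exp (- \<theta> * s) * expectation (\<lambda>\<omega>. w (e s \<omega>)) =
        exp (- \<theta> * s) * expectation (\<lambda>\<omega>. w (inverse_process D s \<omega>))" by simp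
    qed
  qed simp
  finally show ?thesis by (simp add: integral_exponential_density \<phi>_def)
qed

lemma continuous_on_expectation_inverse:
  fixes w :: "real \<Rightarrow> real"
  assumes w: "continuous_on UNIV w" "\<And>u. \<bar>w u\<bar> \<le> C"
  shows "continuous_on {0..} (\<lambda>s. expectation (\<lambda>\<omega>. w (inverse_process D s \<omega>)))"
  unfolding continuous_on_sequentially
proof (intro allI ballI impI, elim conjE)
  fix u :: "nat \<Rightarrow> real" and t :: real
  assume t: "t \<in> {0..}" and u: "\<forall>n. u n \<in> {0..}" "u \<longlonglongrightarrow> t"
  have [measurable]: "w \<in> borel_measurable borel" using w(1) by (rule borel_measurable_continuous_onI)
  have [measurable]: "inverse_process D t \<in> borel_measurable M" "inverse_process D (u n) \<in> borel_measurable M" for n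
    using t u by (auto intro: inverse_measurable)
  have "(\<lambda>n. expectation (\<lambda>\<omega>. w (inverse_process D (u n) \<omega>))) \<longlonglongrightarrow> expectation (\<lambda>\<omega>. w (inverse_process D t \<omega>))"
  proof (rule integral_dominated_convergence[where w = "\<lambda>_. C"])
    show "AE \<omega> in M. (\<lambda>n. w (inverse_process D (u n) \<omega>)) \<longlonglongrightarrow> w (inverse_process D t \<omega>)"
      using AE_regular_path
    proof eventually_elim
      fix \<omega> assume "regular_path (\<lambda>t. D t \<omega>)"
      from isCont_tendsto_compose[OF isCont_inverse_process[where D = D and \<omega> = \<omega>, OF this] u(2)]
      show "(\<lambda>n. w (inverse_process D (u n) \<omega>)) \<longlonglongrightarrow> w (inverse_process D t \<omega>)"
        using w(1) by (intro isCont_tendsto_compose[where g = w]) (auto simp: continuous_on_eq_continuous_at)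
    qed
  qed (use w(2) in auto)
  then show "((\<lambda>s. expectation (\<lambda>\<omega>. w (inverse_process D s \<omega>))) \<circ> u) \<longlonglongrightarrow> expectation (\<lambda>\<omega>. w (inverse_process D t \<omega>))"
    by (simp add: o_def)
qed

lemma Laplace_by_parts:
  fixes g g' :: "real \<Rightarrow> real"
  assumes g: "\<And>u. u \<ge> 0 \<Longrightarrow> (g has_real_derivative g' u) (at u)" "\<And>u. u \<ge> 0 \<Longrightarrow> \<bar>g u\<bar> \<le> C"
    and g': "continuous_on {0..} g'" "\<And>u. u \<ge> 0 \<Longrightarrow> \<bar>g' u\<bar> \<le> C" and \<phi>: "\<phi> > 0"
  shows "\<phi> * (LBINT u:{0..}. exp (- \<phi> * u) * g u) = g 0 + (LBINT u:{0..}. exp (- \<phi> * u) * g' u)"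
proof -
  have g_cont: "continuous_on {0..} g"
    using g(1) by (intro continuous_at_imp_continuous_on) (auto intro: DERIV_isCont)
  have int: "set_integrable lborel {0..} (\<lambda>s. exp (- \<phi> * s) * f s)"
    if "continuous_on {0..} f" "\<And>s. s \<ge> 0 \<Longrightarrow> \<bar>f s\<bar> \<le> C" for f :: "real \<Rightarrow> real"
    using that \<phi> by (intro set_integrable_exp_bound[where a = 0 and C = C] continuous_on_atLeast_borel) auto
  \<comment> \<open>\<open>h\<close> is the derivative of \<open>- exp (- \<phi> * u) * g u\<close>,
    so its integral over \<open>{0..b}\<close> is a boundary term that tends to
    \<open>g 0\<close>.\<close>
  define h where "h = (\<lambda>u. \<phi> * (exp (- \<phi> * u) * g u) - exp (- \<phi> * u) * g' u)"
  have h_int: "set_integrable lborel {0..} h"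
    unfolding h_def using int[OF g_cont g(2)] int[OF g'] by (intro set_integral_diff(1) set_integrable_mult_right) auto
  have "((\<lambda>b. LBINT u:{0..b}. h u) \<longlongrightarrow> (LBINT u:{0..}. h u)) at_top"
    using h_int by (intro tendsto_set_lebesgue_integral_at_top) auto
  moreover have "((\<lambda>b. LBINT u:{0..b}. h u) \<longlongrightarrow> g 0) at_top"
  proof -
    have FTC: "(LBINT u:{0..b}. h u) = - exp (- \<phi> * b) * g b - (- exp (- \<phi> * 0) * g 0)" if "b \<ge> 0" for b
      unfolding set_lebesgue_integral_def
    proof (rule integral_FTC_atLeastAtMost[OF that])
      show "continuous_on {0..b} h"
        unfolding h_def by (intro continuous_intros continuous_on_subset[OF g_cont] continuous_on_subset[OF g'(1)]) auto
      fix x :: real assume "0 \<le> x" "x \<le> b"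
      have "((\<lambda>u. - exp (- \<phi> * u) * g u) has_real_derivative h x) (at x)"
        unfolding h_def using g(1)[OF \<open>0 \<le> x\<close>] by (auto intro!: derivative_eq_intros)
      then show "((\<lambda>u. - exp (- \<phi> * u) * g u) has_vector_derivative h x) (at x within {0..b})"
        by (auto simp: has_real_derivative_iff_has_vector_derivative intro: has_vector_derivative_at_within)
    qed
    have "\<forall>\<^sub>F b in at_top. g 0 - exp (- \<phi> * b) * g b = (LBINT u:{0..b}. h u)"
      using eventually_ge_at_top[of 0] by eventually_elim (simp add: FTC)
    moreover have "((\<lambda>b. exp (- \<phi> * b) * g b) \<longlongrightarrow> 0) at_top"
    proof (rule Lim_null_comparison)
      show "\<forall>\<^sub>F b in at_top. norm (exp (- \<phi> * b) * g b) \<le> exp (- \<phi> * b) * C"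
        using eventually_ge_at_top[of 0] by eventually_elim (auto simp: abs_mult g(2))
      show "((\<lambda>b. exp (- \<phi> * b) * C) \<longlongrightarrow> 0) at_top" using \<phi> by real_asymp
    qed
    then have "((\<lambda>b. g 0 - exp (- \<phi> * b) * g b) \<longlongrightarrow> g 0 - 0) at_top" by (intro tendsto_intros)
    ultimately show ?thesis by (simp add: tendsto_cong)
  qed
  ultimately have "(LBINT u:{0..}. h u) = g 0" by (intro tendsto_unique[OF _ _ _]) auto
  moreover have "(LBINT u:{0..}. h u) = \<phi> * (LBINT u:{0..}. exp (- \<phi> * u) * g u) - (LBINT u:{0..}. exp (- \<phi> * u) * g' u)"
    unfolding h_def using int[OF g_cont g(2)] int[OF g'] by (subst set_integral_diff(2)) auto
  ultimately show ?thesis by simp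
qed

text \<open>Let \<open>I\<close> be the transform of \<open>g'\<close> at \<open>\<phi>\<close>, the
  exponent at \<open>\<theta>\<close>. The exponential time and integration by parts give
  \<open>\<theta>\<close> times the transform of \<open>v\<close> as \<open>g 0 + I\<close>, and
  \<open>\<theta>\<close> times that of \<open>w\<close> as \<open>\<phi> * I\<close>. As
  \<open>v 0 = g 0\<close>, eliminating \<open>I\<close> yields the hypothesis of
  \<open>caputo_djrbashian_of_Laplace\<close>.\<close>

theorem caputo_djrbashian_expectation:
  fixes g g' :: "real \<Rightarrow> real"
  assumes g: "\<And>u. u \<ge> 0 \<Longrightarrow> (g has_real_derivative g' u) (at u)" "\<And>u. u \<ge> 0 \<Longrightarrow> \<bar>g u\<bar> \<le> C"
    and g': "continuous_on {0..} g'" "\<And>u. u \<ge> 0 \<Longrightarrow> \<bar>g' u\<bar> \<le> C" and "t > 0"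
    and v: "\<And>s. s \<ge> 0 \<Longrightarrow> v s = expectation (\<lambda>\<omega>. g (max (inverse_process D s \<omega>) 0))"
  shows "caputo_djrbashian_differentiable \<delta> \<gamma> v t"
    and "caputo_djrbashian_deriv \<delta> \<gamma> v t = expectation (\<lambda>\<omega>. g' (max (inverse_process D t \<omega>) 0))"
proof -
  have g_cont: "continuous_on {0..} g"
    using g(1) by (intro continuous_at_imp_continuous_on) (auto intro: DERIV_isCont)
  define w where "w = (\<lambda>s. expectation (\<lambda>\<omega>. g' (max (inverse_process D s \<omega>) 0)))"
  have max_cont: "continuous_on UNIV (\<lambda>u. f (max u 0))" if "continuous_on {0..} f" for f :: "real \<Rightarrow> real"
    using that by (rule continuous_on_compose2) (auto intro!: continuous_intros)
  have meas: "(\<lambda>\<omega>. f (max (inverse_process D s \<omega>) 0)) \<in> borel_measurable M" if "continuous_on {0..} f" "s \<ge> 0" for f :: "real \<Rightarrow> real" and s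
    using borel_measurable_continuous_onI[OF max_cont[OF that(1)]] inverse_measurable[OF that(2)] by measurable
  have bound: "\<bar>expectation (\<lambda>\<omega>. f (max (inverse_process D s \<omega>) 0))\<bar> \<le> C"
    if "continuous_on {0..} f" "\<And>u. u \<ge> 0 \<Longrightarrow> \<bar>f u\<bar> \<le> C" "s \<ge> 0" for f :: "real \<Rightarrow> real" and s
  proof -
    have "integrable M (\<lambda>\<omega>. f (max (inverse_process D s \<omega>) 0))"
      using that by (intro integrable_const_bound[where B = C] meas) auto
    then have "expectation (\<lambda>\<omega>. \<bar>f (max (inverse_process D s \<omega>) 0)\<bar>) \<le> expectation (\<lambda>_. C)"
      using that by (intro integral_mono) auto
    then have "expectation (\<lambda>\<omega>. \<bar>f (max (inverse_process D s \<omega>) 0)\<bar>) \<le> C" by (simp add: prob_space)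
    with integral_abs_bound show ?thesis by (rule order_trans)
  qed
  have cont: "continuous_on {0..} (\<lambda>s. expectation (\<lambda>\<omega>. f (max (inverse_process D s \<omega>) 0)))"
    if "continuous_on {0..} f" "\<And>u. u \<ge> 0 \<Longrightarrow> \<bar>f u\<bar> \<le> C" for f :: "real \<Rightarrow> real"
    using continuous_on_expectation_inverse[OF max_cont[OF that(1)], of C] that(2) by simp
  have v_cont: "continuous_on {0..} v"
    by (rule continuous_on_eq[OF cont[OF g_cont g(2)]]) (simp_all add: v)
  have v_bound: "\<bar>v s\<bar> \<le> C" if "s \<ge> 0" for s
    using bound[OF g_cont g(2) that] v[OF that] by simp
  have w_cont: "continuous_on {0..} w" and w_bound: "\<And>s. s \<ge> 0 \<Longrightarrow> \<bar>w s\<bar> \<le> C"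
    unfolding w_def using cont[OF g'] bound[OF g'] by auto
  \<comment> \<open>Almost every path of \<open>D\<close> is positive at all positive times, so its
    inverse is 0 at level 0.\<close>
  have v0: "v 0 = g 0"
  proof -
    have "v 0 = expectation (\<lambda>\<omega>. g 0)"
      unfolding v[OF order_refl]
      by (rule integral_cong_AE) (use meas[OF g_cont] AE_regular_path in \<open>auto simp: inverse_process_0 elim: eventually_mono\<close>)
    then show ?thesis by (simp add: prob_space)
  qed
  have Laplace: "ig_exponent \<delta> \<gamma> \<theta> * (LBINT s:{0..}. exp (- \<theta> * s) * (v s - v 0)) = (LBINT s:{0..}. exp (- \<theta> * s) * w s)"
    if \<theta>: "\<theta> > 0" for \<theta>
  proof -
    define \<phi> where "\<phi> = ig_exponent \<delta> \<gamma> \<theta>"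
    have \<phi>: "\<phi> > 0" using ig_exponent_pos[OF \<delta> \<theta>] by (simp add: \<phi>_def)
    define I where "I = (LBINT u:{0..}. exp (- \<phi> * u) * g' u)"
    have time: "\<theta> * (LBINT s:{0..}. exp (- \<theta> * s) * expectation (\<lambda>\<omega>. f (max (inverse_process D s \<omega>) 0)))
        = \<phi> * (LBINT u:{0..}. exp (- \<phi> * u) * f u)"
      if "continuous_on {0..} f" "\<And>u. u \<ge> 0 \<Longrightarrow> \<bar>f u\<bar> \<le> C" for f :: "real \<Rightarrow> real"
    proof -
      have "(LBINT u:{0..}. exp (- \<phi> * u) * f (max u 0)) = (LBINT u:{0..}. exp (- \<phi> * u) * f u)"
        by (rule set_lebesgue_integral_cong) (auto simp: max_def)
      then show ?thesis
        using exponential_time[OF max_cont[OF that(1)] _ \<theta>, of C] that(2) by (simp add: \<phi>_def)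
    qed
    have "\<theta> * (LBINT s:{0..}. exp (- \<theta> * s) * v s)
      = \<theta> * (LBINT s:{0..}. exp (- \<theta> * s) * expectation (\<lambda>\<omega>. g (max (inverse_process D s \<omega>) 0)))"
      by (intro arg_cong2[where f = "(*)"] refl set_lebesgue_integral_cong) (auto simp: v)
    also have "\<dots> = g 0 + I"
      using time[OF g_cont g(2)] Laplace_by_parts[OF g g' \<phi>] by (simp add: I_def)
    finally have Lv: "\<theta> * (LBINT s:{0..}. exp (- \<theta> * s) * v s) = g 0 + I" .
    have Lw: "\<theta> * (LBINT s:{0..}. exp (- \<theta> * s) * w s) = \<phi> * I"
      using time[OF g'] by (simp add: w_def I_def)
    have "(LBINT s:{0..}. exp (- \<theta> * s) * (v s - v 0)) =
      (LBINT s:{0..}. exp (- \<theta> * s) * v s) - (LBINT s:{0..}. exp (- \<theta> * s) * v 0)"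
      unfolding right_diff_distrib
    proof (rule set_integral_diff(2))
      show "set_integrable lborel {0..} (\<lambda>s. exp (- \<theta> * s) * v s)"
        using \<theta> v_bound by (intro set_integrable_exp_bound[where a = 0 and C = C] continuous_on_atLeast_borel[OF v_cont]) auto
      show "set_integrable lborel {0..} (\<lambda>s. exp (- \<theta> * s) * v 0)"
        using set_integrable_exp_neg(1)[OF \<theta>] by (rule set_integrable_mult_left)
    qed
    also have "(LBINT s:{0..}. exp (- \<theta> * s) * v 0) = v 0 / \<theta>"
      using set_integrable_exp_neg[OF \<theta>] by simp
    finally have "\<theta> * (LBINT s:{0..}. exp (- \<theta> * s) * (v s - v 0)) = I"
      using Lv \<theta> by (simp add: v0 right_diff_distrib)
    then have "\<theta> * (\<phi> * (LBINT s:{0..}. exp (- \<theta> * s) * (v s - v 0))) = \<theta> * (LBINT s:{0..}. exp (- \<theta> * s) * w s)"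
      using Lw by (simp add: mult.left_commute)
    then show ?thesis using \<theta> by (simp add: \<phi>_def)
  qed
  show "caputo_djrbashian_differentiable \<delta> \<gamma> v t"
    by (rule caputo_djrbashian_of_Laplace(1)[OF \<delta> \<gamma> v_cont v_bound w_cont w_bound Laplace \<open>t > 0\<close>])
  show "caputo_djrbashian_deriv \<delta> \<gamma> v t = expectation (\<lambda>\<omega>. g' (max (inverse_process D t \<omega>) 0))"
    using caputo_djrbashian_of_Laplace(2)[OF \<delta> \<gamma> v_cont v_bound w_cont w_bound Laplace \<open>t > 0\<close>]
    by (simp add: w_def)
qed

end

section \<open>Time-changed compound Poisson processes\<close>

definition poisson_weight :: "real \<Rightarrow> real \<Rightarrow> nat \<Rightarrow> real" where
  "poisson_weight r u k = exp (- r * u) * ((r * u) ^ k / fact k)"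

definition poisson_mean :: "real \<Rightarrow> (nat \<Rightarrow> real) \<Rightarrow> real \<Rightarrow> real" where
  "poisson_mean r q u = (\<Sum>k. q k * poisson_weight r u k)"

lemma poisson_weight_sums: "poisson_weight r u sums 1"
proof -
  have "(\<lambda>k. exp (- r * u) * ((r * u) ^ k / fact k)) sums (exp (- r * u) * exp (r * u))"
    using exp_converges[of "r * u"] by (intro sums_mult) (simp add: field_simps)
  then show ?thesis by (simp add: poisson_weight_def[abs_def] exp_add[symmetric])
qed

context
  fixes r :: real and q :: "nat \<Rightarrow> real"
  assumes r: "r > 0" and q: "\<And>k. 0 \<le> q k" "\<And>k. q k \<le> 1"
begin

lemma summable_poisson_series: "summable (\<lambda>k. q k * r ^ k / fact k * u ^ k)"
proof (rule summable_comparison_test)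
  have "norm (q k * r ^ k / fact k * u ^ k) \<le> 1 * (inverse (fact k) * \<bar>r * u\<bar> ^ k)" for k
  proof -
    have "norm (q k * r ^ k / fact k * u ^ k) = q k * (inverse (fact k) * \<bar>r * u\<bar> ^ k)"
      using q by (simp add: abs_mult power_mult_distrib power_abs field_simps)
    also have "\<dots> \<le> 1 * (inverse (fact k) * \<bar>r * u\<bar> ^ k)" using q by (intro mult_right_mono) auto
    finally show ?thesis .
  qed
  then show "\<exists>n0. \<forall>k\<ge>n0. norm (q k * r ^ k / fact k * u ^ k) \<le> inverse (fact k) * \<bar>r * u\<bar> ^ k" by simp
  show "summable (\<lambda>k. inverse (fact k) * \<bar>r * u\<bar> ^ k)" by (rule summable_exp)
qed

lemma poisson_mean_summable: "summable (\<lambda>k. q k * poisson_weight r u k)"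
  and poisson_mean_altdef: "poisson_mean r q u = exp (- r * u) * (\<Sum>k. q k * r ^ k / fact k * u ^ k)"
proof -
  have eq: "q k * poisson_weight r u k = exp (- r * u) * (q k * r ^ k / fact k * u ^ k)" for k
    by (simp add: poisson_weight_def power_mult_distrib)
  show "summable (\<lambda>k. q k * poisson_weight r u k)"
    unfolding eq by (intro summable_mult summable_poisson_series)
  show "poisson_mean r q u = exp (- r * u) * (\<Sum>k. q k * r ^ k / fact k * u ^ k)"
    unfolding poisson_mean_def eq by (rule suminf_mult[OF summable_poisson_series])
qed

lemma poisson_mean_bounds:
  assumes "u \<ge> 0"
  shows "0 \<le> poisson_mean r q u" "poisson_mean r q u \<le> 1"
proof -
  have w: "0 \<le> poisson_weight r u k" for k using r assms by (simp add: poisson_weight_def)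
  show "0 \<le> poisson_mean r q u"
    unfolding poisson_mean_def using q w by (intro suminf_nonneg poisson_mean_summable) auto
  have "poisson_mean r q u \<le> (\<Sum>k. poisson_weight r u k)"
    unfolding poisson_mean_def using q w poisson_weight_sums
    by (intro suminf_le poisson_mean_summable) (auto intro: mult_left_le_one_le sums_summable[OF poisson_weight_sums])
  then show "poisson_mean r q u \<le> 1" using sums_unique[OF poisson_weight_sums[of r u]] by simp
qed

lemma ennreal_poisson_mean:
  assumes "u \<ge> 0"
  shows "ennreal (poisson_mean r q u) = (\<Sum>k. ennreal (q k) * ennreal (poisson_weight r u k))"
proof -
  have w: "0 \<le> poisson_weight r u k" for k using r assms by (simp add: poisson_weight_def)
  show ?thesis
    unfolding poisson_mean_def using q w poisson_mean_summable
    by (subst suminf_ennreal2[symmetric]) (auto simp: ennreal_mult)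
qed

end

text \<open>Differentiating the power series termwise shifts its coefficients and produces a factor
  \<open>r\<close>, since \<open>Suc k\<close> cancels against the factorial; the factor
  \<open>exp (- r * u)\<close> contributes the negative term. All real \<open>u\<close> are covered,
  so the derivative at 0 is two-sided.\<close>

lemma poisson_mean_has_derivative:
  assumes r: "r > 0" and q: "\<And>k. 0 \<le> q k" "\<And>k. q k \<le> 1"
  shows "(poisson_mean r q has_real_derivative r * (poisson_mean r (\<lambda>k. q (Suc k)) u - poisson_mean r q u)) (at u)"
proof -
  define S where "S = (\<lambda>q u. \<Sum>k. q k * r ^ k / fact k * u ^ k)"
  have diffs: "diffs (\<lambda>k. q k * r ^ k / fact k) = (\<lambda>k. r * (q (Suc k) * r ^ k / fact k))"
    by (simp add: diffs_def fun_eq_iff field_simps del: of_nat_Suc)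
  have "(S q has_real_derivative (\<Sum>k. diffs (\<lambda>k. q k * r ^ k / fact k) k * u ^ k)) (at u)"
    unfolding S_def by (intro termdiffs_strong_converges_everywhere summable_poisson_series[OF assms])
  also have "(\<Sum>k. diffs (\<lambda>k. q k * r ^ k / fact k) k * u ^ k) = r * S (\<lambda>k. q (Suc k)) u"
    unfolding diffs S_def mult.assoc
    by (rule suminf_mult) (use summable_poisson_series[OF r, of "\<lambda>k. q (Suc k)"] q in \<open>simp add: mult.assoc\<close>)
  finally have D: "(S q has_real_derivative r * S (\<lambda>k. q (Suc k)) u) (at u)" .
  have "((\<lambda>u. exp (- r * u) * S q u) has_real_derivative
      exp (- r * u) * (r * S (\<lambda>k. q (Suc k)) u) - r * exp (- r * u) * S q u) (at u)"
    by (rule derivative_eq_intros D refl)+ (simp add: algebra_simps)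
  also have "exp (- r * u) * (r * S (\<lambda>k. q (Suc k)) u) - r * exp (- r * u) * S q u =
      r * (poisson_mean r (\<lambda>k. q (Suc k)) u - poisson_mean r q u)"
    using q by (simp add: poisson_mean_altdef[OF r] S_def algebra_simps)
  also have "(\<lambda>u. exp (- r * u) * S q u) = poisson_mean r q"
    by (simp add: fun_eq_iff poisson_mean_altdef[OF assms] S_def)
  finally show ?thesis .
qed

lemma continuous_on_poisson_mean:
  assumes "r > 0" "\<And>k. 0 \<le> q k" "\<And>k. q k \<le> 1"
  shows "continuous_on A (poisson_mean r q)"
  by (intro continuous_at_imp_continuous_on ballI DERIV_isCont[OF poisson_mean_has_derivative] assms)

section \<open>Conditioning on a discrete variable\<close>

context prob_space
begin

text \<open>Total probability over the countable partition by the values of \<open>J\<close>. The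
  factor \<open>c\<close> permits nested use: inside an event that is already fixed,
  \<open>c\<close> is the probability of that event.\<close>

lemma prob_mixture:
  fixes J :: "'a \<Rightarrow> nat"
  assumes J[measurable]: "J \<in> measurable M (count_space UNIV)" and A[measurable]: "A \<in> events"
    and h: "\<And>j. 0 \<le> h j" "\<And>j. h j \<le> 1" and c: "0 \<le> c"
    and eq: "\<And>j. prob (A \<inter> {\<omega> \<in> space M. J \<omega> = j}) = c * (h j * prob {\<omega> \<in> space M. J \<omega> = j})"
  shows "prob A = c * expectation (\<lambda>\<omega>. h (J \<omega>))"
proof -
  have int: "integrable M (\<lambda>\<omega>. h (J \<omega>))"
    using h by (intro integrable_const_bound[where B = 1]) auto
  have "(\<Union>j. A \<inter> {\<omega> \<in> space M. J \<omega> = j}) = A" using sets.sets_into_space[OF A] by auto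
  then have "emeasure M A = emeasure M (\<Union>j. A \<inter> {\<omega> \<in> space M. J \<omega> = j})" by simp
  also have "\<dots> = (\<Sum>j. emeasure M (A \<inter> {\<omega> \<in> space M. J \<omega> = j}))"
    by (rule suminf_emeasure[symmetric]) (auto simp: disjoint_family_on_def)
  also have "\<dots> = (\<Sum>j. ennreal c * (\<integral>\<^sup>+\<omega>. ennreal (h j) * indicator {\<omega> \<in> space M. J \<omega> = j} \<omega> \<partial>M))"
  proof (intro suminf_cong)
    fix j
    have "(\<integral>\<^sup>+\<omega>. ennreal (h j) * indicator {\<omega> \<in> space M. J \<omega> = j} \<omega> \<partial>M) = ennreal (h j * prob {\<omega> \<in> space M. J \<omega> = j})"
      using h by (subst nn_integral_cmult_indicator) (auto simp: emeasure_eq_measure ennreal_mult)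
    then show "emeasure M (A \<inter> {\<omega> \<in> space M. J \<omega> = j}) =
        ennreal c * (\<integral>\<^sup>+\<omega>. ennreal (h j) * indicator {\<omega> \<in> space M. J \<omega> = j} \<omega> \<partial>M)"
      using h c by (simp add: emeasure_eq_measure eq ennreal_mult)
  qed
  also have "\<dots> = ennreal c * (\<integral>\<^sup>+\<omega>. (\<Sum>j. ennreal (h j) * indicator {\<omega> \<in> space M. J \<omega> = j} \<omega>) \<partial>M)"
    by (subst nn_integral_suminf) auto
  also have "(\<integral>\<^sup>+\<omega>. (\<Sum>j. ennreal (h j) * indicator {\<omega> \<in> space M. J \<omega> = j} \<omega>) \<partial>M) = (\<integral>\<^sup>+\<omega>. ennreal (h (J \<omega>)) \<partial>M)"
    by (intro nn_integral_cong suminf_cmult_indicator) (auto simp: disjoint_family_on_def)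
  also have "\<dots> = ennreal (expectation (\<lambda>\<omega>. h (J \<omega>)))"
    using int h by (intro nn_integral_eq_integral) auto
  finally have "ennreal (prob A) = ennreal (c * expectation (\<lambda>\<omega>. h (J \<omega>)))"
    using c h by (simp add: emeasure_eq_measure ennreal_mult)
  then show ?thesis using c h by (subst (asm) ennreal_inj) auto
qed

lemma expectation_poisson:
  assumes N: "distr M (count_space UNIV) K = measure_pmf (poisson_pmf (r * s))" "K \<in> measurable M (count_space UNIV)"
    and "r > 0" "s > 0" and q: "\<And>k. 0 \<le> q k" "\<And>k. q k \<le> 1"
  shows "expectation (\<lambda>\<omega>. q (K \<omega>)) = poisson_mean r q s"
proof -
  have rs: "r * s > 0" using assms by simp
  have "ennreal (expectation (\<lambda>\<omega>. q (K \<omega>))) = (\<integral>\<^sup>+\<omega>. ennreal (q (K \<omega>)) \<partial>M)"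
    using q N(2) by (intro nn_integral_eq_integral[symmetric] integrable_const_bound[where B = 1]) auto
  also have "\<dots> = (\<integral>\<^sup>+k. ennreal (q k) \<partial>distr M (count_space UNIV) K)"
    using N(2) by (subst nn_integral_distr) auto
  also have "\<dots> = (\<integral>\<^sup>+k. ennreal (pmf (poisson_pmf (r * s)) k) * ennreal (q k) \<partial>count_space UNIV)"
    unfolding N(1) by (rule nn_integral_measure_pmf)
  also have "\<dots> = (\<Sum>k. ennreal (pmf (poisson_pmf (r * s)) k) * ennreal (q k))"
    by (rule nn_integral_count_space_nat)
  also have "\<dots> = (\<Sum>k. ennreal (q k) * ennreal (poisson_weight r s k))"
    using rs by (simp add: poisson_weight_def mult_ac)
  also have "\<dots> = ennreal (poisson_mean r q s)"
    using assms q by (intro ennreal_poisson_mean[symmetric]) auto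
  finally show ?thesis
    using assms(3,4) q poisson_mean_bounds(1)[OF assms(3), of q s] by (subst (asm) ennreal_inj) auto
qed

end

lemma generated_events_vimage:
  "i \<in> I \<Longrightarrow> A \<in> sets K \<Longrightarrow> Z i -` A \<inter> space M \<in> generated_events M I K Z"
  unfolding generated_events_def by (rule sigma_sets.Basic) auto

text \<open>The time change is abstract here: conditioning uses independence and almost surely
  nonnegative times. Measurability of the compound process is assumed because \<open>N\<close> at a
  random time need not be measurable when its paths are regular only almost surely.\<close>

locale time_changed_compound_poisson = prob_space M for M :: "'a measure" +
  fixes rate :: real and E :: "real \<Rightarrow> 'a \<Rightarrow> real" and N :: "real \<Rightarrow> 'a \<Rightarrow> nat" and X :: "nat \<Rightarrow> 'a \<Rightarrow> real"
    and F :: "real measure"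
  assumes rate: "rate > 0" and poisson: "poisson_process M rate N"
    and indep_N_E: "indep_set (generated_events M {0..} (count_space UNIV) N) (generated_events M {0..} borel E)"
    and indep_X: "indep_vars (\<lambda>_. borel) X {1..}"
    and distr_X: "\<And>i. i \<ge> 1 \<Longrightarrow> distr M borel (X i) = F"
    and indep_X_NE: "indep_set (generated_events M {1..} borel X)
       (sigma_sets (space M) (generated_events M {0..} (count_space UNIV) N \<union> generated_events M {0..} borel E))"
    and compound_measurable: "\<And>t. t \<ge> 0 \<Longrightarrow> compound_process N X E t \<in> borel_measurable M"
    and AE_time_nonneg: "\<And>t. t \<ge> 0 \<Longrightarrow> AE \<omega> in M. E t \<omega> \<ge> 0"
begin

definition jump_sum_pmf :: "real \<Rightarrow> nat \<Rightarrow> real" where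
  "jump_sum_pmf n k = prob {\<omega> \<in> space M. (\<Sum>i = 1..k. X i \<omega>) = n}"

lemma jump_sum_pmf_bounds: "0 \<le> jump_sum_pmf n k" "jump_sum_pmf n k \<le> 1"
  by (simp_all add: jump_sum_pmf_def)

lemma X_measurable: "i \<ge> 1 \<Longrightarrow> X i \<in> borel_measurable M"
  using indep_X by (auto simp: indep_vars_def)

lemma E_measurable: "t \<ge> 0 \<Longrightarrow> E t \<in> borel_measurable M"
  using indep_setD_ev2[OF indep_N_E] by (intro measurableI) (auto intro!: generated_events_vimage)

lemma N_measurable: "t \<ge> 0 \<Longrightarrow> N t \<in> measurable M (count_space UNIV)"
  using indep_setD_ev1[OF indep_N_E] by (intro measurableI) (auto intro!: generated_events_vimage)

text \<open>Independence of jumps and clock refers to the sigma-algebra generated by the jumps, so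
  measurability is established there and not merely in \<open>M\<close>.\<close>

lemma jump_sum_event: "{\<omega> \<in> space M. (\<Sum>i = 1..k. X i \<omega>) = n} \<in> generated_events M {1..} borel X"
proof -
  define G where "G = {X i -` A \<inter> space M | i A. i \<in> {1..} \<and> A \<in> sets borel}"
  have G: "G \<subseteq> Pow (space M)" by (auto simp: G_def)
  have [measurable]: "X i \<in> borel_measurable (sigma (space M) G)" if "i \<in> {1..k}" for i
    using that G by (intro measurableI) (auto simp: G_def intro!: sigma_sets.Basic)
  have "{\<omega> \<in> space (sigma (space M) G). (\<Sum>i = 1..k. X i \<omega>) = n} \<in> sets (sigma (space M) G)"
    by measurable
  then show ?thesis using G by (simp add: generated_events_def G_def)
qed

text \<open>Two factorizations: the jumps are split off from the pair of clock and time change,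
  whose events lie in the sigma-algebra generated by both, and then these two are separated from
  each other.\<close>

lemma prob_jump_time_count:
  assumes "t \<ge> 0" "s \<ge> 0" and B: "B \<in> sets borel"
  shows "prob ({\<omega> \<in> space M. (\<Sum>i = 1..k. X i \<omega>) = n} \<inter> (N s -` {k} \<inter> space M \<inter> (E t -` B \<inter> space M))) =
    jump_sum_pmf n k * (prob (N s -` {k} \<inter> space M) * prob (E t -` B \<inter> space M))"
proof -
  define G where "G = generated_events M {0..} (count_space UNIV) N \<union> generated_events M {0..} borel E"
  have sub: "G \<subseteq> Pow (space M)"
    using indep_setD_ev1[OF indep_N_E] indep_setD_ev2[OF indep_N_E] sets.space_closed[of M] by (auto simp: G_def)
  have NE: "N s -` {k} \<inter> space M \<in> generated_events M {0..} (count_space UNIV) N" "E t -` B \<inter> space M \<in> generated_events M {0..} borel E"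
    using assms by (auto intro!: generated_events_vimage)
  interpret G: sigma_algebra "space M" "sigma_sets (space M) G"
    using sub by (rule sigma_algebra_sigma_sets)
  have "N s -` {k} \<inter> space M \<inter> (E t -` B \<inter> space M) \<in> sigma_sets (space M) G"
    using NE by (intro G.Int sigma_sets.Basic) (auto simp: G_def)
  then show ?thesis
    using indep_setD[OF indep_X_NE jump_sum_event] indep_setD[OF indep_N_E NE]
    by (simp add: G_def jump_sum_pmf_def)
qed

text \<open>\<open>prob_mixture\<close> is nested: fixing the value of \<open>J\<close> freezes the
  time, so that the count is Poisson, and fixing the count freezes the number of summands. The times
  \<open>\<tau> j\<close> are positive because the Poisson law is prescribed at positive
  times.\<close>

lemma prob_compound_simple_time:
  fixes J :: "real \<Rightarrow> nat" and \<tau> :: "nat \<Rightarrow> real"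
  assumes t: "t \<ge> 0" and J[measurable]: "J \<in> measurable borel (count_space UNIV)" and \<tau>: "\<And>j. \<tau> j > 0"
  shows "{\<omega> \<in> space M. (\<Sum>i = 1..N (\<tau> (J (E t \<omega>))) \<omega>. X i \<omega>) = n} \<in> events"
    and "prob {\<omega> \<in> space M. (\<Sum>i = 1..N (\<tau> (J (E t \<omega>))) \<omega>. X i \<omega>) = n} =
      expectation (\<lambda>\<omega>. poisson_mean rate (jump_sum_pmf n) (\<tau> (J (E t \<omega>))))"
proof -
  have [measurable]: "E t \<in> borel_measurable M" using t by (rule E_measurable)
  have N\<tau>[measurable]: "N (\<tau> j) \<in> measurable M (count_space UNIV)" for j using \<tau>[of j] by (intro N_measurable) simp
  have [measurable]: "(\<lambda>\<omega>. N (\<tau> (J (E t \<omega>))) \<omega>) \<in> measurable M (count_space UNIV)"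
    by (rule measurable_compose_countable[where f = "\<lambda>j. N (\<tau> j)"]) measurable
  have sum_meas: "(\<lambda>\<omega>. \<Sum>i = 1..k. X i \<omega>) \<in> borel_measurable M" for k
    by (rule borel_measurable_sum) (use X_measurable in auto)
  have [measurable]: "(\<lambda>\<omega>. \<Sum>i = 1..N (\<tau> (J (E t \<omega>))) \<omega>. X i \<omega>) \<in> borel_measurable M"
    by (rule measurable_compose_countable[where f = "\<lambda>k \<omega>. \<Sum>i = 1..k. X i \<omega>"]) (use sum_meas in measurable)
  define A where "A = {\<omega> \<in> space M. (\<Sum>i = 1..N (\<tau> (J (E t \<omega>))) \<omega>. X i \<omega>) = n}"
  show A: "{\<omega> \<in> space M. (\<Sum>i = 1..N (\<tau> (J (E t \<omega>))) \<omega>. X i \<omega>) = n} \<in> events" by measurable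
  have A'[measurable]: "A \<in> events" using A by (simp add: A_def)
  have "prob A = 1 * expectation (\<lambda>\<omega>. poisson_mean rate (jump_sum_pmf n) (\<tau> (J (E t \<omega>))))"
  proof (rule prob_mixture)
    fix j
    define H where "H = {\<omega> \<in> space M. J (E t \<omega>) = j}"
    have H_eq: "H = E t -` (J -` {j}) \<inter> space M" by (auto simp: H_def)
    have B: "J -` {j} \<in> sets borel" using measurable_sets[OF J, of "{j}"] by simp
    have [measurable]: "H \<in> events" unfolding H_def by measurable
    have "prob (A \<inter> H) = prob H * expectation (\<lambda>\<omega>. jump_sum_pmf n (N (\<tau> j) \<omega>))"
    proof (rule prob_mixture)
      fix k
      have "A \<inter> H \<inter> {\<omega> \<in> space M. N (\<tau> j) \<omega> = k} =
          {\<omega> \<in> space M. (\<Sum>i = 1..k. X i \<omega>) = n} \<inter> (N (\<tau> j) -` {k} \<inter> space M \<inter> (E t -` (J -` {j}) \<inter> space M))"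
        by (auto simp: A_def H_def)
      moreover have "{\<omega> \<in> space M. N (\<tau> j) \<omega> = k} = N (\<tau> j) -` {k} \<inter> space M" by auto
      ultimately show "prob (A \<inter> H \<inter> {\<omega> \<in> space M. N (\<tau> j) \<omega> = k}) =
          prob H * (jump_sum_pmf n k * prob {\<omega> \<in> space M. N (\<tau> j) \<omega> = k})"
        using prob_jump_time_count[OF t _ B, of "\<tau> j" k n] \<tau>[of j] by (simp add: H_eq)
    qed (auto simp: jump_sum_pmf_bounds)
    also have "expectation (\<lambda>\<omega>. jump_sum_pmf n (N (\<tau> j) \<omega>)) = poisson_mean rate (jump_sum_pmf n) (\<tau> j)"
      using poisson \<tau>[of j] rate by (intro expectation_poisson) (auto simp: poisson_process_def jump_sum_pmf_bounds)
    finally show "prob (A \<inter> {\<omega> \<in> space M. J (E t \<omega>) = j}) =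
        1 * (poisson_mean rate (jump_sum_pmf n) (\<tau> j) * prob {\<omega> \<in> space M. J (E t \<omega>) = j})"
      by (simp add: H_def)
  next
    fix j
    show "0 \<le> poisson_mean rate (jump_sum_pmf n) (\<tau> j)" "poisson_mean rate (jump_sum_pmf n) (\<tau> j) \<le> 1"
      using \<tau>[of j] rate jump_sum_pmf_bounds by (auto intro!: poisson_mean_bounds)
  qed auto
  then show "prob {\<omega> \<in> space M. (\<Sum>i = 1..N (\<tau> (J (E t \<omega>))) \<omega>. X i \<omega>) = n} =
      expectation (\<lambda>\<omega>. poisson_mean rate (jump_sum_pmf n) (\<tau> (J (E t \<omega>))))"
    by (simp add: A_def)
qed

text \<open>The time \<open>E t\<close> is approximated from the right by times with countably many values, where independence
  applies directly; the paths of \<open>N\<close> are right-continuous and integer-valued.\<close>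

theorem prob_compound_process:
  assumes t: "t \<ge> 0"
  shows "prob {\<omega> \<in> space M. compound_process N X E t \<omega> = n} =
    expectation (\<lambda>\<omega>. poisson_mean rate (jump_sum_pmf n) (max (E t \<omega>) 0))"
proof -
  define J where "J = (\<lambda>(m::nat) x. nat \<lfloor>real (Suc m) * x\<rfloor>)"
  \<comment> \<open>The index \<open>J\<close> rounds down, and \<open>Suc j\<close> moves to the
    next grid point. Thus the approximating time is strictly above \<open>x\<close>, as the limit
    along \<open>at_right\<close> demands, and is positive.\<close>
  define \<tau> where "\<tau> = (\<lambda>(m::nat) (j::nat). real (Suc j) / real (Suc m))"
  have J[measurable]: "J m \<in> measurable borel (count_space UNIV)" for m unfolding J_def by measurable
  have \<tau>: "\<tau> m j > 0" for m j by (simp add: \<tau>_def)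
  have [measurable]: "E t \<in> borel_measurable M" using t by (rule E_measurable)
  have [measurable]: "poisson_mean rate (jump_sum_pmf n) \<in> borel_measurable borel"
    by (intro borel_measurable_continuous_onI continuous_on_poisson_mean rate jump_sum_pmf_bounds)
  have approx: "x < \<tau> m (J m x)" "\<tau> m (J m x) \<le> x + 1 / real (Suc m)" if "x \<ge> 0" for x m
  proof -
    have "\<tau> m (J m x) = (of_int \<lfloor>real (Suc m) * x\<rfloor> + 1) / real (Suc m)"
      using that by (simp add: \<tau>_def J_def)
    moreover have "(real (Suc m) * x) / real (Suc m) < (of_int \<lfloor>real (Suc m) * x\<rfloor> + 1) / real (Suc m)"
      by (rule divide_strict_right_mono) (linarith, simp)
    moreover have "(of_int \<lfloor>real (Suc m) * x\<rfloor> + 1) / real (Suc m) \<le> (real (Suc m) * x + 1) / real (Suc m)"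
      by (rule divide_right_mono) (linarith, simp)
    moreover have "(real (Suc m) * x + 1) / real (Suc m) = x + 1 / real (Suc m)"
      by (simp add: add_divide_distrib del: of_nat_Suc)
    ultimately show "x < \<tau> m (J m x)" "\<tau> m (J m x) \<le> x + 1 / real (Suc m)" by (simp_all del: of_nat_Suc)
  qed
  have lim: "(\<lambda>m. \<tau> m (J m x)) \<longlonglongrightarrow> x" if "x \<ge> 0" for x
  proof (rule tendsto_sandwich[of "\<lambda>_. x" _ _ "\<lambda>m. x + 1 / real (Suc m)"])
    show "(\<lambda>m. x + 1 / real (Suc m)) \<longlonglongrightarrow> x" by real_asymp
  qed (use approx[OF that] in \<open>auto intro!: always_eventually less_imp_le\<close>)
  define A where "A = (\<lambda>m. {\<omega> \<in> space M. (\<Sum>i = 1..N (\<tau> m (J m (E t \<omega>))) \<omega>. X i \<omega>) = n})"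
  have A: "A m \<in> events" "prob (A m) = expectation (\<lambda>\<omega>. poisson_mean rate (jump_sum_pmf n) (\<tau> m (J m (E t \<omega>))))" for m
    unfolding A_def by (rule prob_compound_simple_time[OF t J \<tau>])+
  define A' where "A' = {\<omega> \<in> space M. compound_process N X E t \<omega> = n}"
  have A': "A' \<in> events" unfolding A'_def using compound_measurable[OF t] by measurable
  have right_cont: "AE \<omega> in M. \<forall>s\<ge>0. ((\<lambda>u. real (N u \<omega>)) \<longlongrightarrow> real (N s \<omega>)) (at_right s)"
    using poisson by (auto simp: poisson_process_def levy_process_def elim: eventually_mono)
  have "(\<lambda>m. expectation (indicator (A m) :: 'a \<Rightarrow> real)) \<longlonglongrightarrow> expectation (indicator A')"
  proof (rule integral_dominated_convergence[where w = "\<lambda>_. 1"])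
    show "AE \<omega> in M. (\<lambda>m. indicator (A m) \<omega> :: real) \<longlonglongrightarrow> indicator A' \<omega>"
      using right_cont AE_time_nonneg[OF t]
    proof eventually_elim
      fix \<omega> assume N: "\<forall>s\<ge>0. ((\<lambda>u. real (N u \<omega>)) \<longlongrightarrow> real (N s \<omega>)) (at_right s)" and nonneg: "0 \<le> E t \<omega>"
      have "filterlim (\<lambda>m. \<tau> m (J m (E t \<omega>))) (at_right (E t \<omega>)) sequentially"
        using lim[OF nonneg] approx(1)[OF nonneg] by (intro filterlim_at_withinI) auto
      then have "(\<lambda>m. real (N (\<tau> m (J m (E t \<omega>))) \<omega>)) \<longlonglongrightarrow> real (N (E t \<omega>) \<omega>)"
        using N nonneg by (auto intro: filterlim_compose)
      \<comment> \<open>Distinct naturals have distance at least 1, so convergence of the counts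
        makes them eventually equal, and the events then agree at \<open>\<omega>\<close>.\<close>
      then have "\<forall>\<^sub>F m in sequentially. dist (real (N (\<tau> m (J m (E t \<omega>))) \<omega>)) (real (N (E t \<omega>) \<omega>)) < 1"
        by (rule tendstoD) simp
      then have "\<forall>\<^sub>F m in sequentially. indicator (A m) \<omega> = (indicator A' \<omega> :: real)"
      proof eventually_elim
        fix m assume "dist (real (N (\<tau> m (J m (E t \<omega>))) \<omega>)) (real (N (E t \<omega>) \<omega>)) < 1"
        then have "N (\<tau> m (J m (E t \<omega>))) \<omega> = N (E t \<omega>) \<omega>" by (simp add: dist_real_def)
        then show "indicator (A m) \<omega> = (indicator A' \<omega> :: real)"
          by (simp add: A_def A'_def compound_process_def indicator_def)
      qed
      then show "(\<lambda>m. indicator (A m) \<omega> :: real) \<longlonglongrightarrow> indicator A' \<omega>" by (rule tendsto_eventually)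
    qed
  qed (use A A' in auto)
  then have "(\<lambda>m. expectation (\<lambda>\<omega>. poisson_mean rate (jump_sum_pmf n) (\<tau> m (J m (E t \<omega>))))) \<longlonglongrightarrow> prob A'"
    using A A' by simp
  moreover have "(\<lambda>m. expectation (\<lambda>\<omega>. poisson_mean rate (jump_sum_pmf n) (\<tau> m (J m (E t \<omega>))))) \<longlonglongrightarrow>
      expectation (\<lambda>\<omega>. poisson_mean rate (jump_sum_pmf n) (max (E t \<omega>) 0))"
  proof (rule integral_dominated_convergence[where w = "\<lambda>_. 1"])
    have "isCont (poisson_mean rate (jump_sum_pmf n)) x" for x
      using poisson_mean_has_derivative[OF rate jump_sum_pmf_bounds] by (rule DERIV_isCont)
    then show "AE \<omega> in M. (\<lambda>m. poisson_mean rate (jump_sum_pmf n) (\<tau> m (J m (E t \<omega>)))) \<longlonglongrightarrow>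
        poisson_mean rate (jump_sum_pmf n) (max (E t \<omega>) 0)"
      using AE_time_nonneg[OF t] by (auto elim!: eventually_mono intro!: isCont_tendsto_compose[OF _ lim] simp: max_def)
    show "AE \<omega> in M. norm (poisson_mean rate (jump_sum_pmf n) (\<tau> m (J m (E t \<omega>)))) \<le> 1" for m
      using poisson_mean_bounds[OF rate jump_sum_pmf_bounds less_imp_le[OF \<tau>]] by (intro AE_I2) simp
  qed (auto simp: \<tau>_def)
  ultimately show ?thesis unfolding A'_def by (rule LIMSEQ_unique)
qed

text \<open>The jump number \<open>Suc k\<close> is independent of the first \<open>k\<close>, so
  their joint law is a product measure. It is evaluated on the line \<open>D\<close> of pairs with
  sum \<open>n\<close>, whose section at \<open>x\<close> is the point \<open>n - x\<close>;
  measurability in \<open>x\<close> is that of the measure of the sections.\<close>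

lemma
  shows jump_sum_pmf_measurable [measurable]: "(\<lambda>x. jump_sum_pmf (n - x) k) \<in> borel_measurable borel"
    and nn_integral_jump_sum_pmf: "(\<integral>\<^sup>+x. ennreal (jump_sum_pmf (n - x) k) \<partial>F) = ennreal (jump_sum_pmf n (Suc k))"
proof -
  define S where "S = (\<lambda>\<omega>. \<Sum>i = 1..k. X i \<omega>)"
  have [measurable]: "S \<in> borel_measurable M" unfolding S_def by (rule borel_measurable_sum) (use X_measurable in auto)
  have [measurable]: "X (Suc k) \<in> borel_measurable M" by (rule X_measurable) simp
  define L where "L = distr M borel S"
  interpret L: prob_space L unfolding L_def by (rule prob_space_distr) measurable
  have F: "F = distr M borel (X (Suc k))" using distr_X[of "Suc k"] by simp
  interpret F: prob_space F unfolding F by (rule prob_space_distr) measurable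
  have sets[measurable_cong]: "sets L = sets borel" "sets F = sets borel" by (simp_all add: L_def F)
  define D where "D = {p \<in> space (borel \<Otimes>\<^sub>M borel :: (real \<times> real) measure). fst p + snd p = n}"
  have D: "D \<in> sets (borel \<Otimes>\<^sub>M borel)" unfolding D_def by measurable
  then have D': "D \<in> sets (F \<Otimes>\<^sub>M L)" by (simp cong: sets_pair_measure_cong add: sets)
  have sec: "emeasure L (Pair x -` D) = ennreal (jump_sum_pmf (n - x) k)" for x
  proof -
    have "S -` (Pair x -` D) \<inter> space M = {\<omega> \<in> space M. (\<Sum>i = 1..k. X i \<omega>) = n - x}"
      by (auto simp: D_def S_def space_pair_measure)
    moreover have "Pair x -` D \<in> sets borel" using D by (rule sets_Pair1)
    ultimately show ?thesis
      by (simp add: L_def emeasure_distr jump_sum_pmf_def emeasure_eq_measure)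
  qed
  have "(\<lambda>x. emeasure L (Pair x -` D)) \<in> borel_measurable F" using D' by (rule L.measurable_emeasure_Pair)
  then have "(\<lambda>x. enn2real (ennreal (jump_sum_pmf (n - x) k))) \<in> borel_measurable borel"
    unfolding sec by measurable
  then show "(\<lambda>x. jump_sum_pmf (n - x) k) \<in> borel_measurable borel" by (simp add: jump_sum_pmf_bounds)
  have "indep_var borel (X (Suc k)) borel S"
    unfolding S_def
    by (rule indep_vars_sum[of "{1..k}" "Suc k" X]) (auto intro: indep_vars_subset[OF indep_X])
  then have pair: "F \<Otimes>\<^sub>M L = distr M (borel \<Otimes>\<^sub>M borel) (\<lambda>\<omega>. (X (Suc k) \<omega>, S \<omega>))"
    unfolding indep_var_distribution_eq F L_def by simp
  have "(\<integral>\<^sup>+x. ennreal (jump_sum_pmf (n - x) k) \<partial>F) = emeasure (F \<Otimes>\<^sub>M L) D"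
    unfolding sec[symmetric] by (rule L.emeasure_pair_measure_alt[OF D', symmetric])
  also have "\<dots> = emeasure M ((\<lambda>\<omega>. (X (Suc k) \<omega>, S \<omega>)) -` D \<inter> space M)"
    unfolding pair using D by (intro emeasure_distr) measurable
  also have "(\<lambda>\<omega>. (X (Suc k) \<omega>, S \<omega>)) -` D \<inter> space M = {\<omega> \<in> space M. (\<Sum>i = 1..Suc k. X i \<omega>) = n}"
    by (auto simp: D_def S_def space_pair_measure add.commute)
  finally show "(\<integral>\<^sup>+x. ennreal (jump_sum_pmf (n - x) k) \<partial>F) = ennreal (jump_sum_pmf n (Suc k))"
    by (simp add: jump_sum_pmf_def emeasure_eq_measure)
qed

text \<open>Averaging over one more jump shifts the coefficient sequence of the Poisson mean. The
  computation takes place among nonnegative series, where the exchanges of sum and integrals are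
  unconditional; the same series shows that \<open>P (n - x)\<close> is measurable in
  \<open>x\<close>.\<close>

theorem integral_prob_compound_process:
  assumes t: "t \<ge> 0"
  defines "P \<equiv> \<lambda>n. prob {\<omega> \<in> space M. compound_process N X E t \<omega> = n}"
  shows "integrable F (\<lambda>x. P (n - x))"
    and "(\<integral>x. P (n - x) \<partial>F) = expectation (\<lambda>\<omega>. poisson_mean rate (\<lambda>k. jump_sum_pmf n (Suc k)) (max (E t \<omega>) 0))"
proof -
  have [measurable]: "E t \<in> borel_measurable M" using t by (rule E_measurable)
  have [measurable]: "X 1 \<in> borel_measurable M" by (rule X_measurable) simp
  have F: "F = distr M borel (X 1)" using distr_X[of 1] by simp
  interpret F: prob_space F unfolding F by (rule prob_space_distr) measurable
  interpret FM: pair_prob_space F M ..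
  have sets[measurable_cong]: "sets F = sets borel" by (simp add: F)
  define u where "u = (\<lambda>\<omega>. max (E t \<omega>) 0)"
  have [measurable]: "u \<in> borel_measurable M" unfolding u_def by measurable
  have [measurable]: "(\<lambda>\<omega>. poisson_weight rate (u \<omega>) k) \<in> borel_measurable M" for k
    unfolding poisson_weight_def by measurable
  have P_nn: "ennreal (expectation (\<lambda>\<omega>. poisson_mean rate q (u \<omega>))) =
      (\<integral>\<^sup>+\<omega>. (\<Sum>k. ennreal (q k) * ennreal (poisson_weight rate (u \<omega>) k)) \<partial>M)"
    if q: "\<And>k. 0 \<le> q k" "\<And>k. q k \<le> 1" for q
  proof -
    have [measurable]: "poisson_mean rate q \<in> borel_measurable borel"
      by (intro borel_measurable_continuous_onI continuous_on_poisson_mean rate q)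
    have b: "0 \<le> poisson_mean rate q (u \<omega>)" "poisson_mean rate q (u \<omega>) \<le> 1" for \<omega>
      using poisson_mean_bounds[OF rate q] by (auto simp: u_def)
    have "ennreal (expectation (\<lambda>\<omega>. poisson_mean rate q (u \<omega>))) = (\<integral>\<^sup>+\<omega>. ennreal (poisson_mean rate q (u \<omega>)) \<partial>M)"
      using b by (intro nn_integral_eq_integral[symmetric] integrable_const_bound[where B = 1]) auto
    also have "\<dots> = (\<integral>\<^sup>+\<omega>. (\<Sum>k. ennreal (q k) * ennreal (poisson_weight rate (u \<omega>) k)) \<partial>M)"
      using ennreal_poisson_mean[OF rate q] by (intro nn_integral_cong) (simp add: u_def)
    finally show ?thesis .
  qed
  have P_eq: "ennreal (P y) = (\<integral>\<^sup>+\<omega>. (\<Sum>k. ennreal (jump_sum_pmf y k) * ennreal (poisson_weight rate (u \<omega>) k)) \<partial>M)" for y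
    unfolding P_def prob_compound_process[OF t] using P_nn[of "jump_sum_pmf y"] by (simp add: jump_sum_pmf_bounds u_def)
  have "(\<lambda>x. enn2real (ennreal (P (n - x)))) \<in> borel_measurable F" unfolding P_eq by measurable
  then have P_meas[measurable]: "(\<lambda>x. P (n - x)) \<in> borel_measurable F" by (simp add: P_def)
  show int: "integrable F (\<lambda>x. P (n - x))"
    by (rule F.integrable_const_bound[where B = 1]) (use P_meas in \<open>simp_all add: P_def\<close>)
  have "ennreal (\<integral>x. P (n - x) \<partial>F) = (\<integral>\<^sup>+x. ennreal (P (n - x)) \<partial>F)"
    using int by (intro nn_integral_eq_integral[symmetric]) (auto simp: P_def)
  also have "\<dots> = (\<integral>\<^sup>+\<omega>. (\<integral>\<^sup>+x. (\<Sum>k. ennreal (jump_sum_pmf (n - x) k) * ennreal (poisson_weight rate (u \<omega>) k)) \<partial>F) \<partial>M)"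
    unfolding P_eq by (rule FM.Fubini'[symmetric]) measurable
  also have "\<dots> = (\<integral>\<^sup>+\<omega>. (\<Sum>k. ennreal (jump_sum_pmf n (Suc k)) * ennreal (poisson_weight rate (u \<omega>) k)) \<partial>M)"
    by (intro nn_integral_cong) (simp add: nn_integral_suminf nn_integral_multc nn_integral_jump_sum_pmf)
  also have "\<dots> = ennreal (expectation (\<lambda>\<omega>. poisson_mean rate (\<lambda>k. jump_sum_pmf n (Suc k)) (u \<omega>)))"
    by (rule P_nn[symmetric]) (auto simp: jump_sum_pmf_bounds)
  finally show "(\<integral>x. P (n - x) \<partial>F) = expectation (\<lambda>\<omega>. poisson_mean rate (\<lambda>k. jump_sum_pmf n (Suc k)) (max (E t \<omega>) 0))"
    unfolding u_def
    by (subst (asm) ennreal_inj)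
      (auto simp: P_def intro!: integral_nonneg_AE AE_I2 poisson_mean_bounds(1) rate jump_sum_pmf_bounds)
qed

end

section \<open>The fractional differential equation\<close>

theorem theorem5p3:
  fixes M :: "'a measure"
    and \<delta> \<gamma> rate :: real
    and D E Y :: "real \<Rightarrow> 'a \<Rightarrow> real"
    and N :: "real \<Rightarrow> 'a \<Rightarrow> nat"
    and X :: "nat \<Rightarrow> 'a \<Rightarrow> real"
    and F\<^sub>X :: "real measure"
    and P :: "real \<Rightarrow> real \<Rightarrow> real"
  assumes "prob_space M"
    and "\<delta> > 0" and "\<gamma> > 0" and "rate > 0"
    and "inverse_gaussian_subordinator M \<delta> \<gamma> D"
    and E_def: "E = inverse_process D"
    and "poisson_process M rate N"
    and indep_N_E: "prob_space.indep_set M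
           (generated_events M {0..} (count_space UNIV) N) (generated_events M {0..} borel E)"
    and iid_indep: "prob_space.indep_vars M (\<lambda>_. borel) X {1..}"
    and iid_distr: "\<And>i. i \<ge> 1 \<Longrightarrow> distr M borel (X i) = F\<^sub>X"
    and indep_X_NE: "prob_space.indep_set M
           (generated_events M {1..} borel X)
           (sigma_sets (space M)
              (generated_events M {0..} (count_space UNIV) N \<union> generated_events M {0..} borel E))"
    and Y_def: "Y = compound_process N X E"
    and Y_rv: "\<And>t. t \<ge> 0 \<Longrightarrow> Y t \<in> borel_measurable M"
    and P_def: "\<And>n t. P n t = measure M {\<omega> \<in> space M. Y t \<omega> = n}"
  shows "\<forall>n. \<forall>t>0.
           caputo_djrbashian_differentiable \<delta> \<gamma> (\<lambda>s. P n s) t \<and>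
           integrable F\<^sub>X (\<lambda>x. P (n - x) t) \<and>
           caputo_djrbashian_deriv \<delta> \<gamma> (\<lambda>s. P n s) t =
             - rate * P n t + rate * (\<integral>x. P (n - x) t \<partial>F\<^sub>X)"
proof (intro allI impI)
  interpret prob_space M by fact
  note indep_NE = indep_N_E[unfolded E_def]
  interpret first_passage: ig_first_passage M \<delta> \<gamma> D
  proof
    \<comment> \<open>Independence of generated events includes that they are events of
      \<open>M\<close>; this is the source of the measurability of the first-passage time.\<close>
    fix t :: real assume "t \<ge> 0"
    then show "inverse_process D t \<in> borel_measurable M"
      using indep_setD_ev2[OF indep_NE] by (intro measurableI) (auto intro!: generated_events_vimage)
  qed fact+
  interpret time_changed_compound_poisson M rate E N X F\<^sub>X
  proof
    fix t :: real
    show "AE \<omega> in M. E t \<omega> \<ge> 0"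
      using first_passage.AE_regular_path unfolding E_def by eventually_elim (rule inverse_process_nonneg)
  qed (use assms in auto)
  fix n t :: real assume t: "t > 0"
  define q where "q = jump_sum_pmf n"
  have q: "0 \<le> q k" "q k \<le> 1" for k by (simp_all add: q_def jump_sum_pmf_bounds)
  define g where "g = poisson_mean rate q"
  define h where "h = poisson_mean rate (\<lambda>k. q (Suc k))"
  have P: "P y s = expectation (\<lambda>\<omega>. poisson_mean rate (jump_sum_pmf y) (max (inverse_process D s \<omega>) 0))" if "s \<ge> 0" for y s
    using prob_compound_process[OF that] by (simp add: P_def Y_def E_def)
  have bounds: "0 \<le> g u" "g u \<le> 1" "0 \<le> h u" "h u \<le> 1" if "u \<ge> 0" for u
    unfolding g_def h_def using that by (auto intro!: poisson_mean_bounds rate q)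
  \<comment> \<open>A single constant has to bound \<open>g\<close>, which is at most 1, and its
    derivative, which is at most \<open>rate\<close> in absolute value.\<close>
  have g_bound: "\<bar>g u\<bar> \<le> 1 + rate" and g'_bound: "\<bar>rate * (h u - g u)\<bar> \<le> 1 + rate" if "u \<ge> 0" for u
  proof -
    have "\<bar>h u - g u\<bar> \<le> 1" using bounds[OF that] by linarith
    then have "\<bar>rate * (h u - g u)\<bar> \<le> rate * 1"
      unfolding abs_mult using rate by (intro mult_mono) auto
    then show "\<bar>rate * (h u - g u)\<bar> \<le> 1 + rate" by simp
    show "\<bar>g u\<bar> \<le> 1 + rate" using bounds[OF that] rate by linarith
  qed
  have deriv: "(g has_real_derivative rate * (h u - g u)) (at u)" for u
    unfolding g_def h_def by (intro poisson_mean_has_derivative rate q)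
  have cont: "continuous_on A g" "continuous_on A h" for A
    unfolding g_def h_def by (intro continuous_on_poisson_mean rate q)+
  then have g'_cont: "continuous_on {0..} (\<lambda>u. rate * (h u - g u))"
    by (intro continuous_intros)
  have v: "P n s = expectation (\<lambda>\<omega>. g (max (inverse_process D s \<omega>) 0))" if "s \<ge> 0" for s
    using P[OF that] by (simp add: g_def q_def)
  note caputo = first_passage.caputo_djrbashian_expectation[OF deriv g_bound g'_cont g'_bound t v]
  have int: "integrable M (\<lambda>\<omega>. f (max (inverse_process D t \<omega>) 0))"
    if "continuous_on UNIV f" "\<And>u. u \<ge> 0 \<Longrightarrow> 0 \<le> f u \<and> f u \<le> 1" for f :: "real \<Rightarrow> real"
    using that t first_passage.inverse_measurable[of t] borel_measurable_continuous_onI[OF that(1)]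
    by (intro integrable_const_bound[where B = 1]) auto
  have jump: "integrable F\<^sub>X (\<lambda>x. P (n - x) t)"
    "(\<integral>x. P (n - x) t \<partial>F\<^sub>X) = expectation (\<lambda>\<omega>. h (max (inverse_process D t \<omega>) 0))"
    using integral_prob_compound_process[of t n] t by (simp_all add: P_def Y_def E_def h_def q_def)
  \<comment> \<open>Linearity splits the mean of the derivative of \<open>g\<close>: the mean of
    \<open>h\<close> is the convolution of \<open>P\<close> with \<open>F\<^sub>X\<close>, and the
    mean of \<open>g\<close> is \<open>P n t\<close>.\<close>
  have "expectation (\<lambda>\<omega>. rate * (h (max (inverse_process D t \<omega>) 0) - g (max (inverse_process D t \<omega>) 0))) =
      rate * ((\<integral>x. P (n - x) t \<partial>F\<^sub>X) - P n t)"
    using int[OF cont(1)] int[OF cont(2)] bounds t by (simp add: jump v)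
  with caputo jump(1) show "caputo_djrbashian_differentiable \<delta> \<gamma> (\<lambda>s. P n s) t \<and>
      integrable F\<^sub>X (\<lambda>x. P (n - x) t) \<and>
      caputo_djrbashian_deriv \<delta> \<gamma> (\<lambda>s. P n s) t = - rate * P n t + rate * (\<integral>x. P (n - x) t \<partial>F\<^sub>X)"
    by (simp add: algebra_simps)
qed

end
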